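(* Let $(\nu_n)_{n\ge1}$ be a sequence of strictly aperiodic probability measures on $\mathbb{Z}$ such that (1) $E(\nu_n)=\sum_{k\in\mathbb{Z}}k\,\nu_n(k)=0$ for all $n$; (2) $\phi(n)=\sum_{i=1}^{n} m_2(\nu_i)=O(n)$, where $m_2(\nu)=\sum_{k\in\mathbb{Z}}k^2\nu(k)$; (3) there exist a constant $C>0$ and an integer $N_0>0$ such that $|\hat{\nu}_n(t)|\le e^{-Ct^2}$ for all $n>N_0$ and all $t\in[-1/2,1/2)$. Let $\mu_n=\nu_1*\nu_2*\cdots*\nu_n$. Then $$\sup_{n}\int_{-1/2}^{1/2}|\hat{\mu}_n''(t)|\,|t|\,dt<\infty,$$ and consequently the maximal operator $Mf(x)=\sup_{n}|\mu_nf(x)|$ is of weak type $(1,1)$: there is a constant $C'$ such that for every $\lambda>0$ and every $f\in L^1(X)$, $m\{x\in X: Mf(x)>\lambda\}\le \frac{C'}{\lambda}\|f\|_1$.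
   Context: $(X,\mathcal{B},m)$ is a non-atomic separable probability space and $\tau:X\to X$ is an invertible measure-preserving transformation. For a probability measure $\mu$ on $\mathbb{Z}$ and $f\in L^1(X)$, $\mu f(x)=\sum_{k\in\mathbb{Z}}\mu(k)f(\tau^kx)$. The Fourier transform of a probability measure $\mu$ on $\mathbb{Z}$ is $\hat{\mu}(t)=\sum_{k\in\mathbb{Z}}\mu(k)e^{2\pi ikt}$, $t\in[-1/2,1/2)$. Convolution: $(\mu*\nu)(k)=\sum_{j\in\mathbb{Z}}\mu(k-j)\nu(j)$. A probability measure on $\mathbb{Z}$ is strictly aperiodic if its support is not contained in any proper coset of a subgroup of $\mathbb{Z}$ (equivalently $|\hat\mu(t)|<1$ for all $t\in[-1/2,1/2)\setminus\{0\}$). *)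

theory Defs
  imports "HOL-Probability.Probability" "HOL-Library.Landau_Symbols"
begin

definition fourier :: "int pmf \<Rightarrow> real \<Rightarrow> complex" where
  "fourier \<nu> t = (\<Sum>\<^sub>\<infinity>k\<in>(UNIV::int set). complex_of_real (pmf \<nu> k) * cis (2 * pi * real_of_int k * t))"

definition m2 :: "int pmf \<Rightarrow> real" where
  "m2 \<nu> = (\<Sum>\<^sub>\<infinity>k\<in>(UNIV::int set). (real_of_int k)\<^sup>2 * pmf \<nu> k)"

definition mean :: "int pmf \<Rightarrow> real" where
  "mean \<nu> = (\<Sum>\<^sub>\<infinity>k\<in>(UNIV::int set). real_of_int k * pmf \<nu> k)"

definition conv_pmf :: "int pmf \<Rightarrow> int pmf \<Rightarrow> int pmf" where
  "conv_pmf p q = map_pmf (\<lambda>(a, b). a + b) (pair_pmf p q)"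

fun mu :: "(nat \<Rightarrow> int pmf) \<Rightarrow> nat \<Rightarrow> int pmf" where
  "mu \<nu> 0 = return_pmf 0"
| "mu \<nu> (Suc n) = conv_pmf (mu \<nu> n) (\<nu> (Suc n))"

definition int_subgroup :: "int set \<Rightarrow> bool" where
  "int_subgroup H \<longleftrightarrow> 0 \<in> H \<and> (\<forall>a\<in>H. \<forall>b\<in>H. a + b \<in> H) \<and> (\<forall>a\<in>H. - a \<in> H)"

definition strictly_aperiodic :: "int pmf \<Rightarrow> bool" where
  "strictly_aperiodic \<nu> \<longleftrightarrow>
     (\<forall>H a. int_subgroup H \<and> (\<lambda>h. a + h) ` H \<noteq> UNIV \<longrightarrow> \<not> set_pmf \<nu> \<subseteq> (\<lambda>h. a + h) ` H)"

definition non_atomic :: "'a measure \<Rightarrow> bool" where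
  "non_atomic M \<longleftrightarrow> (\<forall>A\<in>sets M. measure M A > 0 \<longrightarrow>
      (\<exists>B\<in>sets M. B \<subseteq> A \<and> 0 < measure M B \<and> measure M B < measure M A))"

definition separable_measure :: "'a measure \<Rightarrow> bool" where
  "separable_measure M \<longleftrightarrow> (\<exists>\<C>. countable \<C> \<and> \<C> \<subseteq> sets M \<and>
      (\<forall>A\<in>sets M. \<forall>e>0. \<exists>B\<in>\<C>. measure M ((A - B) \<union> (B - A)) < e))"

definition measure_preserving_map :: "'a measure \<Rightarrow> ('a \<Rightarrow> 'a) \<Rightarrow> bool" where
  "measure_preserving_map M T \<longleftrightarrow> T \<in> measurable M M \<and> distr M M T = M"

definition tpow :: "'a measure \<Rightarrow> ('a \<Rightarrow> 'a) \<Rightarrow> int \<Rightarrow> 'a \<Rightarrow> 'a" where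
  "tpow M \<tau> k = (if k \<ge> 0 then \<tau> ^^ nat k else (the_inv_into (space M) \<tau>) ^^ nat (- k))"

definition avg :: "'a measure \<Rightarrow> ('a \<Rightarrow> 'a) \<Rightarrow> int pmf \<Rightarrow> ('a \<Rightarrow> real) \<Rightarrow> 'a \<Rightarrow> real" where
  "avg M \<tau> p f x = (\<Sum>\<^sub>\<infinity>k\<in>(UNIV::int set). pmf p k * f (tpow M \<tau> k x))"

end

(* Write h for the transform of mu_n. Differentiating the product of the n transforms twice and using
   |nu_i''| <= 4 pi^2 m2(nu_i) and, since the means vanish, |nu_i'(t)| <= 4 pi^2 m2(nu_i) |t| gives
   |h''(t)| <= K (n + n^2 t^2) exp(-C n t^2) <= D n / (1 + n t^2)^2 and |h(t)| <= D / (1 + n t^2).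
   Integrating against |t| gives the first claim. For the second, integrating h and h'' without weight
   gives mu_n(k) <= const / sqrt n and k^2 mu_n(k) <= const * sqrt n, that is,
   mu_n(k) <= const * sqrt n / (sqrt n + |k|)^2. These kernels are decreasing in |k| with uniformly
   bounded sums, so by Abel summation the maximal operator is dominated by the maximal Birkhoff averages
   of |f| along tau and its inverse, and the maximal ergodic theorem applies; no Calderon-Zygmund
   decomposition is needed. *)

theory Submission
  imports Defs
begin

section \<open>Absolutely convergent Fourier series\<close>

text \<open>A transform and its two termwise derivatives are all series \<open>fser a\<close> with
  absolutely summable coefficients, so continuity, differentiation and recovery of coefficients are
  proved once, for arbitrary \<open>a\<close>. A finite second moment is precisely absolute
  summability of the coefficients of the second derivative. The obstacle in the estimates is lost
  decay: the first \<open>N0\<close> factors need not decay at all, and each differentiation removes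
  the decay of one more factor. For |t| <= 1/2 a missing factor exp(-C t^2) can be restored at the
  price exp(C/4), and at most N0 + 2 are missing, so the total loss is a constant independent of n
  and t. The exponential is then weakened to powers of 1 / (1 + n t^2) because this function has an
  arctangent primitive and total mass at most pi / sqrt n; every sqrt n in the kernel bounds comes
  from there. The two bounds for mu_n(k) are of the same order at |k| = sqrt n, which is why the
  kernel has that scale. The level set of the maximal function is never measured itself; it is
  enclosed in a measurable set built from Birkhoff sums.\<close>

definition fser :: "(int \<Rightarrow> complex) \<Rightarrow> real \<Rightarrow> complex" where
  "fser a t = (\<Sum>\<^sub>\<infinity>k. a k * cis (2 * pi * real_of_int k * t))"

lemma fser_uniform_limit:
  assumes "(\<lambda>k. norm (a k)) summable_on UNIV"
  shows "uniform_limit T (\<lambda>F t. \<Sum>k\<in>F. a k * cis (2 * pi * real_of_int k * t)) (fser a)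
    (finite_subsets_at_top UNIV)"
  unfolding fser_def
  by (rule Weierstrass_m_test_general[OF _ assms]) (simp add: norm_mult)

lemma fser_summable:
  assumes "(\<lambda>k. norm (a k)) summable_on UNIV"
  shows "(\<lambda>k. a k * cis (2 * pi * real_of_int k * t)) summable_on UNIV"
  by (rule abs_summable_summable) (use assms in \<open>simp add: norm_mult\<close>)

lemma continuous_on_fser:
  assumes "(\<lambda>k. norm (a k)) summable_on UNIV"
  shows "continuous_on T (fser a)"
proof (rule uniform_limit_theorem[OF _ fser_uniform_limit[OF assms]])
  show "\<forall>\<^sub>F F in finite_subsets_at_top UNIV. continuous_on T (\<lambda>t. \<Sum>k\<in>F. a k * cis (2 * pi * real_of_int k * t))"
    by (intro always_eventually allI continuous_intros)
qed simp

lemma norm_fser_le: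
  assumes "(\<lambda>k. norm (a k)) summable_on UNIV"
  shows "norm (fser a t) \<le> (\<Sum>\<^sub>\<infinity>k. norm (a k))"
  using norm_infsum_bound[of "\<lambda>k. a k * cis (2 * pi * real_of_int k * t)" UNIV] assms
  by (simp add: fser_def norm_mult)

lemma cis_has_vector_derivative:
  "((\<lambda>t. c * cis (w * t)) has_vector_derivative (\<i> * w * c * cis (w * t))) (at t within S)"
proof -
  have "((\<lambda>z. c * exp (\<i> * w * z)) has_field_derivative (\<i> * w * c * exp (\<i> * w * of_real t))) (at (of_real t))"
    by (auto intro!: derivative_eq_intros)
  from has_vector_derivative_real_field[OF this] show ?thesis
    by (simp add: cis_conv_exp mult.assoc)
qed

text \<open>The differentiated series converges uniformly by the M-test, so it may be integrated
  term by term, and each finite partial sum is covered by the fundamental theorem of calculus.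
  Differentiating a limit is thus replaced by integrating one.\<close>

lemma has_integral_fser_deriv:
  fixes a :: "int \<Rightarrow> complex"
  defines "b \<equiv> \<lambda>k. 2 * pi * \<i> * of_int k * a k"
  assumes a: "(\<lambda>k. norm (a k)) summable_on UNIV"
    and ka: "(\<lambda>k. \<bar>real_of_int k\<bar> * norm (a k)) summable_on UNIV"
    and st: "s \<le> t"
  shows "(fser b has_integral (fser a t - fser a s)) {s..t}"
proof -
  have bs: "(\<lambda>k. norm (b k)) summable_on UNIV"
    using summable_on_cmult_right[OF ka, of "2 * pi"] by (simp add: b_def norm_mult algebra_simps)
  obtain I J where I: "\<And>F. ((\<lambda>u. \<Sum>k\<in>F. b k * cis (2 * pi * real_of_int k * u)) has_integral I F) {s..t}"
    and J: "(fser b has_integral J) {s..t}" and lim: "(I \<longlongrightarrow> J) (finite_subsets_at_top UNIV)"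
    by (rule uniform_limit_integral[OF fser_uniform_limit[OF bs]])
       (auto intro!: continuous_intros)
  have IF: "I F = (\<Sum>k\<in>F. a k * cis (2 * pi * real_of_int k * t)) - (\<Sum>k\<in>F. a k * cis (2 * pi * real_of_int k * s))" for F
  proof -
    have "((\<lambda>u. \<Sum>k\<in>F. b k * cis (2 * pi * real_of_int k * u)) has_integral
      (\<Sum>k\<in>F. a k * cis (2 * pi * real_of_int k * t)) - (\<Sum>k\<in>F. a k * cis (2 * pi * real_of_int k * s))) {s..t}"
      by (rule fundamental_theorem_of_calculus[OF st], rule has_vector_derivative_sum)
         (use cis_has_vector_derivative[of "a _" "2 * pi * real_of_int _"] in \<open>simp add: b_def mult_ac\<close>)
    with I show ?thesis by (rule has_integral_unique)
  qed
  have fs: "((\<lambda>F. \<Sum>k\<in>F. a k * cis (2 * pi * real_of_int k * u)) \<longlongrightarrow> fser a u) (finite_subsets_at_top UNIV)" for u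
    using fser_uniform_limit[OF a, of UNIV] by (rule tendsto_uniform_limitI) simp
  have "(I \<longlongrightarrow> fser a t - fser a s) (finite_subsets_at_top UNIV)"
    unfolding IF[abs_def] by (intro tendsto_diff fs)
  with lim have "J = fser a t - fser a s"
    using tendsto_unique finite_subsets_at_top_neq_bot by blast
  with J show ?thesis by simp
qed

text \<open>By the integral identity above, \<open>fser a\<close> is near t a constant plus an
  indefinite integral of a continuous function. The window of radius 1 only serves to keep t in the
  interior.\<close>

lemma fser_has_vector_derivative:
  fixes a :: "int \<Rightarrow> complex"
  assumes a: "(\<lambda>k. norm (a k)) summable_on UNIV"
    and ka: "(\<lambda>k. \<bar>real_of_int k\<bar> * norm (a k)) summable_on UNIV"
  shows "(fser a has_vector_derivative fser (\<lambda>k. 2 * pi * \<i> * of_int k * a k) t) (at t)"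
proof -
  let ?b = "\<lambda>k. 2 * pi * \<i> * of_int k * a k"
  have bs: "(\<lambda>k. norm (?b k)) summable_on UNIV"
    using summable_on_cmult_right[OF ka, of "2 * pi"] by (simp add: norm_mult algebra_simps)
  have "((\<lambda>u. integral {t-1..u} (fser ?b)) has_vector_derivative fser ?b t) (at t within {t-1..t+1})"
    by (rule integral_has_vector_derivative[OF continuous_on_fser[OF bs]]) simp
  then have 1: "((\<lambda>u. integral {t-1..u} (fser ?b) + fser a (t - 1)) has_vector_derivative fser ?b t) (at t within {t-1..t+1})"
    using has_vector_derivative_add_const[of "\<lambda>u. integral {t-1..u} (fser ?b)"] by simp
  have "(fser a has_vector_derivative fser ?b t) (at t within {t-1..t+1})"
  proof (rule has_vector_derivative_transform[OF _ _ 1])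
    fix u assume "u \<in> {t-1..t+1}"
    then show "fser a u = integral {t-1..u} (fser ?b) + fser a (t - 1)"
      using integral_unique[OF has_integral_fser_deriv[OF a ka, of "t-1" u]] by simp
  qed simp
  then show ?thesis
    using at_within_Icc_at[of "t - 1" t "t + 1"] by simp
qed

text \<open>Fourier inversion for one coefficient: multiply by the conjugate character, integrate
  over a period term by term, and orthogonality leaves only \<open>a k\<close>.\<close>

lemma norm_coeff_le_integral_fser:
  assumes a: "(\<lambda>k. norm (a k)) summable_on UNIV"
  shows "norm (a k) \<le> integral {-1/2..1/2} (\<lambda>t. norm (fser a t))"
proof -
  let ?c = "\<lambda>t. cis (- (2 * pi * real_of_int k * t))"
  define g where "g j t = a j * cis (2 * pi * real_of_int (j - k) * t)" for j t
  have gint: "(g j has_integral (if j = k then a k else 0)) {-1/2..1/2}" for j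
  proof (cases "j = k")
    case True
    then have "g j = (\<lambda>_. a k)" by (auto simp: g_def)
    moreover have "((\<lambda>_::real. a k) has_integral a k) {-1/2..1/2}"
      using has_integral_const_real[of "a k" "-1/2" "1/2"] by simp
    ultimately show ?thesis using True by simp
  next
    case False
    \<comment> \<open>\<open>w\<close> is a nonzero integer multiple of 2 pi, so the primitive
      \<open>G\<close> has equal values at both ends of the period.\<close>
    define w where "w = 2 * pi * real_of_int (j - k)"
    have w0: "w \<noteq> 0" using False by (simp add: w_def)
    define G where "G t = a j / (\<i> * w) * cis (w * t)" for t
    have "(g j has_integral (G (1/2) - G (-1/2))) {-1/2..1/2}"
    proof (rule fundamental_theorem_of_calculus)
      fix t
      show "(G has_vector_derivative g j t) (at t within {-1/2..1/2})"
        using cis_has_vector_derivative[of "a j / (\<i> * w)" w t] w0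
        by (simp add: G_def[abs_def] g_def w_def)
    qed simp
    moreover have "cis (w * (1/2)) = cis (w * (-1/2))"
    proof -
      have "cis (w * (1/2)) = cis (w * (-1/2)) * cis w"
        by (simp add: cis_mult)
      also have "cis w = 1" unfolding w_def by (rule cis_multiple_2pi) simp
      finally show ?thesis by simp
    qed
    ultimately show ?thesis using False by (simp add: G_def)
  qed
  have "(\<Sum>\<^sub>\<infinity>j. g j t) = fser a t * ?c t" for t
  proof -
    have "g j t = a j * cis (2 * pi * real_of_int j * t) * ?c t" for j
      by (simp add: g_def mult.assoc cis_mult algebra_simps)
    then have "(\<Sum>\<^sub>\<infinity>j. g j t) = (\<Sum>\<^sub>\<infinity>j. a j * cis (2 * pi * real_of_int j * t) * ?c t)"
      by presburger
    also have "\<dots> = fser a t * ?c t"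
      unfolding fser_def by (rule infsum_cmult_left) (rule fser_summable[OF a])
    finally show ?thesis .
  qed
  moreover have "uniform_limit {-1/2..1/2} (\<lambda>F t. \<Sum>j\<in>F. g j t) (\<lambda>t. \<Sum>\<^sub>\<infinity>j. g j t) (finite_subsets_at_top UNIV)"
    by (rule Weierstrass_m_test_general[OF _ a]) (simp add: norm_mult g_def)
  ultimately have ul: "uniform_limit {-1/2..1/2} (\<lambda>F t. \<Sum>j\<in>F. g j t) (\<lambda>t. fser a t * ?c t) (finite_subsets_at_top UNIV)"
    by simp
  obtain I J where I: "\<And>F. ((\<lambda>t. \<Sum>j\<in>F. g j t) has_integral I F) {-1/2..1/2}"
    and J: "((\<lambda>t. fser a t * ?c t) has_integral J) {-1/2..1/2}"
    and lim: "(I \<longlongrightarrow> J) (finite_subsets_at_top UNIV)"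
    by (rule uniform_limit_integral[OF ul]) (auto intro!: continuous_intros simp: g_def)
  \<comment> \<open>The net of integrals is constant as soon as F contains k, so its limit is that
    constant.\<close>
  have "I F = a k" if "finite F" "{k} \<subseteq> F" for F
  proof -
    have "((\<lambda>t. \<Sum>j\<in>F. g j t) has_integral (\<Sum>j\<in>F. if j = k then a k else 0)) {-1/2..1/2}"
      by (intro has_integral_sum gint that)
    from has_integral_unique[OF I this] that show ?thesis by simp
  qed
  then have "\<forall>\<^sub>F F in finite_subsets_at_top UNIV. I F = a k"
    unfolding eventually_finite_subsets_at_top by (intro exI[of _ "{k}"]) auto
  then have "(I \<longlongrightarrow> a k) (finite_subsets_at_top UNIV)"
    by (rule tendsto_eventually)
  with lim have "J = a k"
    using tendsto_unique finite_subsets_at_top_neq_bot by blast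
  with J have "a k = integral {-1/2..1/2} (\<lambda>t. fser a t * ?c t)"
    by (simp add: integral_unique)
  also have "norm \<dots> \<le> integral {-1/2..1/2} (\<lambda>t. norm (fser a t))"
    by (rule integral_norm_bound_integral)
       (auto intro!: integrable_continuous_real continuous_intros continuous_on_fser[OF a] simp: norm_mult)
  finally show ?thesis .
qed

section \<open>Transforms of measures with finite second moment\<close>

text \<open>Bridge between unordered sums, in which the definitions are written, and Bochner
  integrals over \<open>measure_pmf\<close>, which is counting measure with density
  \<open>pmf p\<close>.\<close>

lemma abs_summable_pmf_iff:
  fixes f :: "'a \<Rightarrow> 'b::{banach, second_countable_topology}"
  shows "(\<lambda>k. norm (pmf p k *\<^sub>R f k)) summable_on UNIV \<longleftrightarrow> integrable (measure_pmf p) f"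
proof -
  have "integrable (measure_pmf p) f \<longleftrightarrow> Infinite_Set_Sum.abs_summable_on (\<lambda>k. pmf p k *\<^sub>R f k) UNIV"
    unfolding measure_pmf_eq_density Infinite_Set_Sum.abs_summable_on_def by (rule integrable_density) auto
  then show ?thesis by (simp only: abs_summable_equivalent)
qed

lemma infsum_pmf:
  fixes f :: "'a \<Rightarrow> 'b::{banach, second_countable_topology}"
  assumes "integrable (measure_pmf p) f"
  shows "(\<Sum>\<^sub>\<infinity>k. pmf p k *\<^sub>R f k) = (\<integral>k. f k \<partial>measure_pmf p)"
proof -
  have "Infinite_Set_Sum.abs_summable_on (\<lambda>k. pmf p k *\<^sub>R f k) UNIV"
    using assms abs_summable_pmf_iff[of p f] abs_summable_equivalent by blast
  from infsetsum_infsum[OF this] show ?thesis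
    unfolding measure_pmf_eq_density infsetsum_def by (subst integral_density) auto
qed

text \<open>Fubini at the level of double series: integrability of the product is absolute
  summability over pairs, which permits summing one variable at a time.\<close>

lemma expectation_pair_pmf_mult:
  fixes f :: "'a::countable \<Rightarrow> complex" and g :: "'b::countable \<Rightarrow> complex"
  assumes f: "integrable (measure_pmf p) f" and g: "integrable (measure_pmf q) g"
    and fg: "integrable (measure_pmf (pair_pmf p q)) (\<lambda>x. f (fst x) * g (snd x))"
  shows "(\<integral>x. f (fst x) * g (snd x) \<partial>measure_pmf (pair_pmf p q)) =
    (\<integral>a. f a \<partial>measure_pmf p) * (\<integral>b. g b \<partial>measure_pmf q)"
proof -
  let ?h = "\<lambda>a b. (pmf p a *\<^sub>R f a) * (pmf q b *\<^sub>R g b)"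
  have h: "pmf (pair_pmf p q) x *\<^sub>R (f (fst x) * g (snd x)) = (case x of (a, b) \<Rightarrow> ?h a b)" for x
    by (cases x) (simp add: pmf_pair scaleR_conv_of_real)
  have "(\<lambda>x. norm (case x of (a, b) \<Rightarrow> ?h a b)) summable_on UNIV"
    using fg[folded abs_summable_pmf_iff] unfolding h .
  then have s: "(\<lambda>(a, b). ?h a b) summable_on UNIV \<times> UNIV"
    using abs_summable_summable by fastforce
  have qs: "(\<lambda>b. pmf q b *\<^sub>R g b) summable_on UNIV"
    by (rule abs_summable_summable) (use g abs_summable_pmf_iff in blast)
  have ps: "(\<lambda>a. pmf p a *\<^sub>R f a) summable_on UNIV"
    by (rule abs_summable_summable) (use f abs_summable_pmf_iff in blast)
  have "(\<integral>x. f (fst x) * g (snd x) \<partial>measure_pmf (pair_pmf p q)) = (\<Sum>\<^sub>\<infinity>x. case x of (a, b) \<Rightarrow> ?h a b)"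
    by (simp only: infsum_pmf[OF fg, symmetric] h)
  also have "\<dots> = (\<Sum>\<^sub>\<infinity>a. \<Sum>\<^sub>\<infinity>b. ?h a b)"
    using infsum_Sigma'_banach[OF s] by simp
  also have "\<dots> = (\<Sum>\<^sub>\<infinity>a. (pmf p a *\<^sub>R f a) * (\<Sum>\<^sub>\<infinity>b. pmf q b *\<^sub>R g b))"
    by (intro infsum_cong infsum_cmult_right qs)
  also have "\<dots> = (\<Sum>\<^sub>\<infinity>a. pmf p a *\<^sub>R f a) * (\<Sum>\<^sub>\<infinity>b. pmf q b *\<^sub>R g b)"
    by (intro infsum_cmult_left ps)
  finally show ?thesis by (simp add: infsum_pmf f g)
qed

lemma integrable_cis_pmf: "integrable (measure_pmf p) (\<lambda>x. cis (h x))"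
  by (rule measure_pmf.integrable_const_bound[where B = 1]) auto

lemma fourier_eq_expectation:
  "fourier p t = (\<integral>k. cis (2 * pi * real_of_int k * t) \<partial>measure_pmf p)"
  using infsum_pmf[OF integrable_cis_pmf, of p "\<lambda>k. 2 * pi * real_of_int k * t"]
  by (simp add: fourier_def scaleR_conv_of_real)

lemma fourier_conv_pmf: "fourier (conv_pmf p q) t = fourier p t * fourier q t"
proof -
  let ?e = "\<lambda>k. cis (2 * pi * real_of_int k * t)"
  have e: "?e (a + b) = ?e a * ?e b" for a b
    by (simp add: cis_mult algebra_simps)
  have "fourier (conv_pmf p q) t = (\<integral>x. ?e (fst x) * ?e (snd x) \<partial>measure_pmf (pair_pmf p q))"
    by (simp only: fourier_eq_expectation conv_pmf_def integral_map_pmf case_prod_unfold e)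
  also have "\<dots> = fourier p t * fourier q t"
    unfolding fourier_eq_expectation
    by (intro expectation_pair_pmf_mult integrable_cis_pmf) (simp only: cis_mult integrable_cis_pmf)
  finally show ?thesis .
qed

text \<open>The number \<open>m2 p\<close> cannot express finiteness, since \<open>infsum\<close> is
  0 on families that are not summable.\<close>

definition finite_m2 :: "int pmf \<Rightarrow> bool" where
  "finite_m2 p \<longleftrightarrow> (\<lambda>k. (real_of_int k)\<^sup>2 * pmf p k) summable_on UNIV"

lemma finite_m2_iff_integrable: "finite_m2 p \<longleftrightarrow> integrable (measure_pmf p) (\<lambda>k. (real_of_int k)\<^sup>2)"
  by (simp add: abs_summable_pmf_iff[symmetric] finite_m2_def abs_mult mult.commute)

lemma finite_m2_conv_pmf:
  assumes "finite_m2 p" "finite_m2 q"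
  shows "finite_m2 (conv_pmf p q)"
proof -
  have "integrable (map_pmf fst (pair_pmf p q)) (\<lambda>k. (real_of_int k)\<^sup>2)"
       "integrable (map_pmf snd (pair_pmf p q)) (\<lambda>k. (real_of_int k)\<^sup>2)"
    using assms by (simp_all add: map_fst_pair_pmf map_snd_pair_pmf finite_m2_iff_integrable)
  then have i: "integrable (pair_pmf p q) (\<lambda>x. 2 * (real_of_int (fst x))\<^sup>2 + 2 * (real_of_int (snd x))\<^sup>2)"
    by simp
  have "(a + b)\<^sup>2 \<le> 2 * a\<^sup>2 + 2 * b\<^sup>2" for a b :: real
    using zero_le_power2[of "a - b"] by (simp add: power2_eq_square algebra_simps)
  then have "integrable (pair_pmf p q) (\<lambda>x. (real_of_int (fst x + snd x))\<^sup>2)"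
    by (intro Bochner_Integration.integrable_bound[OF i]) auto
  then show ?thesis
    by (simp add: finite_m2_iff_integrable conv_pmf_def case_prod_unfold)
qed

lemma finite_m2_return_pmf: "finite_m2 (return_pmf a)"
  unfolding finite_m2_iff_integrable by (rule integrable_measure_pmf_finite) simp

lemma summable_pmf: "pmf p summable_on A"
  using pmf_abs_summable[of p A] abs_summable_equivalent[of "pmf p" A] by auto

lemma summable_m1:
  assumes "finite_m2 p"
  shows "(\<lambda>k. \<bar>real_of_int k\<bar> * pmf p k) summable_on UNIV"
proof (rule summable_on_comparison_test)
  show "(\<lambda>k. (real_of_int k)\<^sup>2 * pmf p k) summable_on UNIV"
    using assms by (simp add: finite_m2_def)
  fix k
  have "\<bar>real_of_int k\<bar> \<le> (real_of_int k)\<^sup>2"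
  proof -
    have "\<bar>real_of_int k\<bar> * 1 \<le> \<bar>real_of_int k\<bar> * \<bar>real_of_int k\<bar>"
      by (cases "k = 0") (auto intro!: mult_left_mono simp del: abs_mult_self_eq)
    then show ?thesis by (simp add: power2_eq_square)
  qed
  then show "\<bar>real_of_int k\<bar> * pmf p k \<le> (real_of_int k)\<^sup>2 * pmf p k"
    by (rule mult_right_mono) simp
qed simp

definition fourier1 :: "int pmf \<Rightarrow> real \<Rightarrow> complex" where
  "fourier1 p = fser (\<lambda>k. 2 * pi * \<i> * of_int k * pmf p k)"

text \<open>The factors are left unmerged so that the coefficients have literally the form that
  \<open>fser_has_vector_derivative\<close> produces from those of \<open>fourier1\<close>.\<close>

definition fourier2 :: "int pmf \<Rightarrow> real \<Rightarrow> complex" where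
  "fourier2 p = fser (\<lambda>k. 2 * pi * \<i> * of_int k * (2 * pi * \<i> * of_int k * pmf p k))"

lemma fourier_eq_fser: "fourier p = fser (\<lambda>k. complex_of_real (pmf p k))"
  by (simp add: fourier_def[abs_def] fser_def[abs_def])

lemma summable_norm_coeff1:
  assumes "finite_m2 p"
  shows "(\<lambda>k. norm (2 * pi * \<i> * of_int k * pmf p k)) summable_on UNIV"
  using summable_on_cmult_right[OF summable_m1[OF assms], of "2 * pi"] by (simp add: norm_mult mult.assoc)

lemma norm_coeff2:
  "norm (2 * pi * \<i> * of_int k * (2 * pi * \<i> * of_int k * pmf p k)) = 4 * pi\<^sup>2 * ((real_of_int k)\<^sup>2 * pmf p k)"
proof -
  have "norm (2 * pi * \<i> * of_int k * (2 * pi * \<i> * of_int k * pmf p k)) =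
    4 * pi\<^sup>2 * ((\<bar>real_of_int k\<bar> * \<bar>real_of_int k\<bar>) * pmf p k)"
    by (simp add: norm_mult power2_eq_square)
  then show ?thesis by (simp add: power2_eq_square)
qed

lemma summable_norm_coeff2:
  assumes "finite_m2 p"
  shows "(\<lambda>k. norm (2 * pi * \<i> * of_int k * (2 * pi * \<i> * of_int k * pmf p k))) summable_on UNIV"
  unfolding norm_coeff2 using assms by (intro summable_on_cmult_right) (simp add: finite_m2_def)

lemma fourier_has_vector_derivative:
  assumes "finite_m2 p"
  shows "(fourier p has_vector_derivative fourier1 p t) (at t)"
  unfolding fourier_eq_fser fourier1_def
  by (rule fser_has_vector_derivative) (use summable_pmf summable_m1[OF assms] in auto)

lemma fourier1_has_vector_derivative:
  assumes "finite_m2 p"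
  shows "(fourier1 p has_vector_derivative fourier2 p t) (at t)"
  unfolding fourier1_def fourier2_def
proof (rule fser_has_vector_derivative)
  show "(\<lambda>k. norm (2 * pi * \<i> * of_int k * pmf p k)) summable_on UNIV"
    by (rule summable_norm_coeff1[OF assms])
  have eq: "norm (2 * pi * \<i> * of_int k * (2 * pi * \<i> * of_int k * pmf p k)) =
    (2 * pi) * (\<bar>real_of_int k\<bar> * norm (2 * pi * \<i> * of_int k * pmf p k))" for k
    by (simp add: norm_mult)
  have "(\<lambda>k. (2 * pi) * (\<bar>real_of_int k\<bar> * norm (2 * pi * \<i> * of_int k * pmf p k))) summable_on UNIV"
    using summable_norm_coeff2[OF assms] unfolding eq .
  then show "(\<lambda>k. \<bar>real_of_int k\<bar> * norm (2 * pi * \<i> * of_int k * pmf p k)) summable_on UNIV"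
    by (subst (asm) summable_on_cmult_right') auto
qed

lemma norm_fourier_le_1: "norm (fourier p t) \<le> 1"
  unfolding fourier_eq_expectation
  using integral_norm_bound[of "measure_pmf p" "\<lambda>k. cis (2 * pi * real_of_int k * t)"] by simp

lemma norm_fourier2_le:
  assumes "finite_m2 p"
  shows "norm (fourier2 p t) \<le> 4 * pi\<^sup>2 * m2 p"
proof -
  have "norm (fourier2 p t) \<le> (\<Sum>\<^sub>\<infinity>k. 4 * pi\<^sup>2 * ((real_of_int k)\<^sup>2 * pmf p k))"
    unfolding fourier2_def using norm_fser_le[OF summable_norm_coeff2[OF assms]] by (simp only: norm_coeff2)
  also have "\<dots> = 4 * pi\<^sup>2 * m2 p"
    unfolding m2_def by (rule infsum_cmult_right) (use assms in \<open>simp add: finite_m2_def\<close>)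
  finally show ?thesis .
qed

lemma fourier1_0:
  assumes "finite_m2 p"
  shows "fourier1 p 0 = 2 * pi * \<i> * mean p"
proof -
  have "(\<lambda>k. norm (real_of_int k * pmf p k)) summable_on UNIV"
    using summable_m1[OF assms] by (simp add: abs_mult)
  then have s: "(\<lambda>k. real_of_int k * pmf p k) summable_on UNIV"
    by (rule abs_summable_summable)
  have "fourier1 p 0 = (\<Sum>\<^sub>\<infinity>k. 2 * pi * \<i> * complex_of_real (real_of_int k * pmf p k))"
    by (simp add: fourier1_def fser_def mult.assoc)
  also have "\<dots> = 2 * pi * \<i> * (\<Sum>\<^sub>\<infinity>k. complex_of_real (real_of_int k * pmf p k))"
    by (rule infsum_cmult_right) (rule summable_on_of_real[OF s])
  also have "(\<Sum>\<^sub>\<infinity>k. complex_of_real (real_of_int k * pmf p k)) = mean p"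
    unfolding mean_def
    by (rule infsum_bounded_linear_strong) (use s summable_on_of_real[OF s] bounded_linear_of_real in blast)+
  finally show ?thesis .
qed

text \<open>Mean zero makes \<open>fourier1 p\<close> vanish at 0; the mean value inequality with
  the uniform bound on \<open>fourier2 p\<close> does the rest.\<close>

lemma norm_fourier1_le:
  assumes p: "finite_m2 p" and m: "mean p = 0"
  shows "norm (fourier1 p t) \<le> 4 * pi\<^sup>2 * m2 p * \<bar>t\<bar>"
proof -
  have "norm (fourier1 p t - fourier1 p 0) \<le> 4 * pi\<^sup>2 * m2 p * norm (t - 0)"
  proof (rule differentiable_bound[of UNIV "fourier1 p" "\<lambda>x h. h *\<^sub>R fourier2 p x"])
    show "(fourier1 p has_derivative (\<lambda>h. h *\<^sub>R fourier2 p x)) (at x within UNIV)" for x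
      using fourier1_has_vector_derivative[OF p] by (simp add: has_vector_derivative_def)
    show "onorm (\<lambda>h. h *\<^sub>R fourier2 p x) \<le> 4 * pi\<^sup>2 * m2 p" for x
      using norm_fourier2_le[OF p, of x] by (intro onorm_le) (simp add: mult.commute mult_left_mono)
  qed auto
  then show ?thesis by (simp add: fourier1_0[OF p] m)
qed

text \<open>The series are not rearranged: convolution turns into a product of transforms, and
  uniqueness of derivatives carries the Leibniz rule over to the termwise derivatives.\<close>

lemma fourier1_conv_pmf:
  assumes p: "finite_m2 p" and q: "finite_m2 q"
  shows "fourier1 (conv_pmf p q) t = fourier p t * fourier1 q t + fourier1 p t * fourier q t"
proof (rule vector_derivative_unique_at)
  show "(fourier (conv_pmf p q) has_vector_derivative fourier1 (conv_pmf p q) t) (at t)"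
    by (intro fourier_has_vector_derivative finite_m2_conv_pmf p q)
  show "(fourier (conv_pmf p q) has_vector_derivative fourier p t * fourier1 q t + fourier1 p t * fourier q t) (at t)"
    unfolding fourier_conv_pmf[abs_def]
    by (intro has_vector_derivative_mult fourier_has_vector_derivative p q)
qed

lemma fourier2_conv_pmf:
  assumes p: "finite_m2 p" and q: "finite_m2 q"
  shows "fourier2 (conv_pmf p q) t =
    fourier p t * fourier2 q t + 2 * fourier1 p t * fourier1 q t + fourier2 p t * fourier q t"
proof (rule vector_derivative_unique_at)
  show "(fourier1 (conv_pmf p q) has_vector_derivative fourier2 (conv_pmf p q) t) (at t)"
    by (intro fourier1_has_vector_derivative finite_m2_conv_pmf p q)
  have "((\<lambda>t. fourier p t * fourier1 q t + fourier1 p t * fourier q t) has_vector_derivative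
    (fourier p t * fourier2 q t + fourier1 p t * fourier1 q t) +
    (fourier1 p t * fourier1 q t + fourier2 p t * fourier q t)) (at t)"
    by (intro has_vector_derivative_add has_vector_derivative_mult fourier_has_vector_derivative
        fourier1_has_vector_derivative p q)
  then show "(fourier1 (conv_pmf p q) has_vector_derivative
    fourier p t * fourier2 q t + 2 * fourier1 p t * fourier1 q t + fourier2 p t * fourier q t) (at t)"
    by (simp add: fourier1_conv_pmf[OF p q, abs_def] algebra_simps)
qed

text \<open>The coefficients are real, so reflection is conjugation. This supplies the endpoint 1/2,
  which the half-open interval of the decay hypothesis omits.\<close>

lemma norm_fourier_minus: "norm (fourier p (- t)) = norm (fourier p t)"
proof -
  have "fourier p (- t) = cnj (fourier p t)"
    unfolding fourier_def infsum_cnj[symmetric] by (simp add: cis_cnj)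
  then show ?thesis by simp
qed

lemma pmf_le_integral_fourier:
  "pmf p k \<le> integral {-1/2..1/2} (\<lambda>t. norm (fourier p t))"
  using norm_coeff_le_integral_fser[of "\<lambda>k. complex_of_real (pmf p k)" k] summable_pmf[of p UNIV]
  by (simp add: fourier_eq_fser)

lemma pmf_le_integral_fourier2:
  assumes "finite_m2 p"
  shows "4 * pi\<^sup>2 * ((real_of_int k)\<^sup>2 * pmf p k) \<le> integral {-1/2..1/2} (\<lambda>t. norm (fourier2 p t))"
  using norm_coeff_le_integral_fser[OF summable_norm_coeff2[OF assms], of k]
  unfolding fourier2_def norm_coeff2 .

lemma continuous_on_fourier: "continuous_on T (fourier p)"
  unfolding fourier_eq_fser by (rule continuous_on_fser) (use summable_pmf in auto)

lemma continuous_on_fourier2: "finite_m2 p \<Longrightarrow> continuous_on T (fourier2 p)"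
  unfolding fourier2_def by (intro continuous_on_fser summable_norm_coeff2)

section \<open>Decay of the transforms of the convolution products\<close>

lemma finite_m2_mu:
  assumes "\<And>i. i \<ge> 1 \<Longrightarrow> finite_m2 (\<nu> i)"
  shows "finite_m2 (mu \<nu> n)"
  by (induction n) (auto intro!: finite_m2_conv_pmf finite_m2_return_pmf assms)

lemma m2_nonneg: "m2 p \<ge> 0"
  unfolding m2_def by (rule infsum_nonneg) simp

text \<open>Each derivative drops one factor from the product of transforms, which costs at most \<open>1 / q\<close>.\<close>

lemma fourier_mu_bounds:
  fixes q t :: real and N0 :: nat
  assumes fin: "\<And>i. i \<ge> 1 \<Longrightarrow> finite_m2 (\<nu> i)"
    and mean0: "\<And>i. i \<ge> 1 \<Longrightarrow> mean (\<nu> i) = 0"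
    and q: "0 < q" "q \<le> 1"
    and decay: "\<And>i. i > N0 \<Longrightarrow> norm (fourier (\<nu> i) t) \<le> q"
  defines "a \<equiv> 4 * pi\<^sup>2" and "\<phi> \<equiv> \<lambda>n. \<Sum>i=1..n. m2 (\<nu> i)" and "P \<equiv> \<lambda>n. q ^ (n - N0)"
  shows "norm (fourier (mu \<nu> n) t) \<le> P n"
    and "norm (fourier1 (mu \<nu> n) t) \<le> a * \<phi> n * \<bar>t\<bar> * (P n / q)"
    and "norm (fourier2 (mu \<nu> n) t) \<le> a * \<phi> n * (P n / q) + (a * \<phi> n * t)\<^sup>2 * (P n / q\<^sup>2)"
proof (induction n)
  case 0
  have "(real_of_int k)\<^sup>2 * pmf (return_pmf 0) k = 0" "real_of_int k * pmf (return_pmf 0) k = 0" for k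
    by (auto simp: pmf_return indicator_def split: if_splits)
  then have m: "m2 (return_pmf 0) = 0" "mean (return_pmf 0) = 0"
    by (simp_all only: m2_def mean_def infsum_0_simp)
  {
    case 1
    show ?case by (simp add: P_def norm_fourier_le_1)
  next
    case 2
    show ?case using norm_fourier1_le[OF finite_m2_return_pmf m(2)] by (simp add: m \<phi>_def)
  next
    case 3
    show ?case using norm_fourier2_le[OF finite_m2_return_pmf] m by (simp add: \<phi>_def) (metis m(1) mult_zero_right norm_le_zero_iff)
  }
next
  case (Suc n)
  let ?p = "mu \<nu> n" and ?v = "\<nu> (Suc n)"
  define m where "m = m2 ?v"
  \<comment> \<open>\<open>b\<close> bounds the new factor: 1 among the first \<open>N0\<close>,
    where no decay is known, and q afterwards. Truncated subtraction in \<open>P\<close> makes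
    \<open>P (Suc n) = P n * b\<close> hold in both cases.\<close>
  define b where "b = (if Suc n > N0 then q else 1)"
  have a: "a \<ge> 0" by (simp add: a_def)
  have \<phi>: "\<phi> n \<ge> 0" unfolding \<phi>_def by (intro sum_nonneg m2_nonneg)
  have m: "m \<ge> 0" by (simp add: m_def m2_nonneg)
  have \<phi>S: "\<phi> (Suc n) = \<phi> n + m" by (simp add: \<phi>_def m_def)
  have v: "finite_m2 ?v" "mean ?v = 0" using fin mean0 by auto
  have p: "finite_m2 ?p" by (rule finite_m2_mu[OF fin])
  have P0: "P n \<ge> 0" using q by (simp add: P_def)
  have PS: "P (Suc n) = P n * b"
  proof (cases "Suc n > N0")
    case True
    then have "Suc n - N0 = Suc (n - N0)" by simp
    then show ?thesis using True by (simp add: P_def b_def)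
  qed (simp add: P_def b_def)
  have qb: "q \<le> b" using q by (simp add: b_def)
  then have b0: "b > 0" using q by simp
  have "P n * q \<le> P n * b" using P0 qb by (rule mult_left_mono[rotated])
  \<comment> \<open>Needed where the derivative hits the new factor and its bound b is absent; since
    q <= b, dividing by q compensates.\<close>
  then have PU: "P n \<le> P (Suc n) / q" using q by (simp add: PS pos_le_divide_eq)
  then have PU2: "P n / q \<le> P (Suc n) / q\<^sup>2"
    using q divide_right_mono[OF PU, of q] by (simp add: power2_eq_square)
  have x: "norm (fourier ?v t) \<le> b"
    using decay[of "Suc n"] norm_fourier_le_1 by (auto simp: b_def)
  have y: "norm (fourier1 ?v t) \<le> a * m * \<bar>t\<bar>"
    unfolding a_def m_def by (rule norm_fourier1_le[OF v])
  have z: "norm (fourier2 ?v t) \<le> a * m"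
    unfolding a_def m_def by (rule norm_fourier2_le[OF v(1)])
  note IH = Suc
  {
    case 1
    have "norm (fourier ?p t) * norm (fourier ?v t) \<le> P n * b"
      by (intro mult_mono IH(1) x P0) simp
    then show ?case by (simp add: fourier_conv_pmf norm_mult PS)
  next
    case 2
    have "norm (fourier1 (mu \<nu> (Suc n)) t) \<le>
      norm (fourier ?p t) * norm (fourier1 ?v t) + norm (fourier1 ?p t) * norm (fourier ?v t)"
      by (simp add: fourier1_conv_pmf[OF p v(1)] norm_triangle_le norm_mult)
    also have "\<dots> \<le> P n * (a * m * \<bar>t\<bar>) + (a * \<phi> n * \<bar>t\<bar> * (P n / q)) * b"
      using a \<phi> P0 q by (intro add_mono mult_mono IH x y) auto
    also have "\<dots> \<le> (P (Suc n) / q) * (a * m * \<bar>t\<bar>) + (a * \<phi> n * \<bar>t\<bar> * (P n / q)) * b"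
      using a m by (intro add_right_mono mult_right_mono PU) auto
    also have "\<dots> = a * \<phi> (Suc n) * \<bar>t\<bar> * (P (Suc n) / q)"
      by (simp add: PS \<phi>S algebra_simps add_divide_distrib)
    finally show ?case .
  next
    case 3
    have "norm (fourier2 (mu \<nu> (Suc n)) t) \<le>
      norm (fourier ?p t) * norm (fourier2 ?v t) + 2 * (norm (fourier1 ?p t) * norm (fourier1 ?v t))
      + norm (fourier2 ?p t) * norm (fourier ?v t)"
      unfolding mu.simps fourier2_conv_pmf[OF p v(1)]
      by (intro order_trans[OF norm_triangle_ineq] add_mono) (simp_all add: norm_mult)
    also have "\<dots> \<le> P n * (a * m) + 2 * ((a * \<phi> n * \<bar>t\<bar> * (P n / q)) * (a * m * \<bar>t\<bar>))
      + (a * \<phi> n * (P n / q) + (a * \<phi> n * t)\<^sup>2 * (P n / q\<^sup>2)) * b"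
      using a \<phi> P0 q by (intro add_mono mult_mono IH x y z) auto
    also have "\<dots> = P n * (a * m) + (2 * (a * \<phi> n) * (a * m) * t\<^sup>2) * (P n / q)
      + (a * \<phi> n * (P (Suc n) / q) + (a * \<phi> n * t)\<^sup>2 * (P (Suc n) / q\<^sup>2))"
      by (simp add: PS algebra_simps power2_eq_square)
    also have "\<dots> \<le> (P (Suc n) / q) * (a * m) + (2 * (a * \<phi> n) * (a * m) * t\<^sup>2) * (P (Suc n) / q\<^sup>2)
      + (a * \<phi> n * (P (Suc n) / q) + (a * \<phi> n * t)\<^sup>2 * (P (Suc n) / q\<^sup>2))"
      using a m \<phi> by (intro add_mono mult_right_mono[OF PU] mult_left_mono[OF PU2]) auto
    \<comment> \<open>With x = a * \<phi> n * t and y = a * m * t, the cross term and the old square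
      are 2xy + x^2 = (x + y)^2 - y^2; the negative part is dropped next.\<close>
    also have "\<dots> = a * \<phi> (Suc n) * (P (Suc n) / q) +
      ((a * \<phi> (Suc n) * t)\<^sup>2 - (a * m * t)\<^sup>2) * (P (Suc n) / q\<^sup>2)"
      unfolding \<phi>S power2_eq_square by algebra
    also have "\<dots> \<le> a * \<phi> (Suc n) * (P (Suc n) / q) + (a * \<phi> (Suc n) * t)\<^sup>2 * (P (Suc n) / q\<^sup>2)"
      using P0 b0 q by (intro add_left_mono mult_right_mono) (auto simp: PS)
    finally show ?case .
  }
qed

text \<open>Why a cube: in \<open>fourier_mu_decay\<close> one factor 1 + u absorbs a polynomial
  that is linear in u, and the other two form the denominator (1 + u)^2.\<close>

lemma exp_minus_le_cubic:
  fixes C u :: real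
  assumes "C > 0"
  obtains E where "E > 0" "\<And>u. u \<ge> 0 \<Longrightarrow> exp (- C * u) * (1 + u) ^ 3 \<le> E"
proof
  \<comment> \<open>Chosen so that d (1 + u) <= 1 + C u / 3 <= exp (C u / 3); cubing gives the
    claim.\<close>
  define d where "d = min 1 (C / 3)"
  have d: "d > 0" "d \<le> 1" "d \<le> C / 3" using assms by (auto simp: d_def)
  show "(1 / d) ^ 3 > 0" using d by simp
  fix u :: real assume u: "u \<ge> 0"
  have "d * (1 + u) \<le> 1 + C / 3 * u"
    using d u mult_right_mono[OF d(3) u] by (simp add: distrib_left)
  also have "\<dots> \<le> exp (C / 3 * u)" by (rule exp_ge_add_one_self)
  finally have "(d * (1 + u)) ^ 3 \<le> exp (C / 3 * u) ^ 3"
    using d u by (intro power_mono) auto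
  also have "\<dots> = exp (C * u)" by (simp flip: exp_of_nat_mult)
  finally have "d ^ 3 * (1 + u) ^ 3 \<le> exp (C * u)" by (simp add: power_mult_distrib)
  then show "exp (- C * u) * (1 + u) ^ 3 \<le> (1 / d) ^ 3"
    using d by (simp add: exp_minus field_simps)
qed

lemma fourier_mu_decay:
  assumes fin: "\<And>i. i \<ge> 1 \<Longrightarrow> finite_m2 (\<nu> i)"
    and mean0: "\<And>i. i \<ge> 1 \<Longrightarrow> mean (\<nu> i) = 0"
    and c: "c \<ge> 0" "\<And>n. n \<ge> 1 \<Longrightarrow> (\<Sum>i=1..n. m2 (\<nu> i)) \<le> c * real n"
    and C: "C > 0" "\<And>n t. n > N0 \<Longrightarrow> \<bar>t\<bar> \<le> 1/2 \<Longrightarrow> norm (fourier (\<nu> n) t) \<le> exp (- C * t\<^sup>2)"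
  obtains D where "D > 0"
    "\<And>n t. n \<ge> 1 \<Longrightarrow> \<bar>t\<bar> \<le> 1/2 \<Longrightarrow> norm (fourier (mu \<nu> n) t) \<le> D / (1 + real n * t\<^sup>2)"
    "\<And>n t. n \<ge> 1 \<Longrightarrow> \<bar>t\<bar> \<le> 1/2 \<Longrightarrow> norm (fourier2 (mu \<nu> n) t) \<le> D * real n / (1 + real n * t\<^sup>2)\<^sup>2"
proof -
  obtain E where E: "E > 0" "\<And>u. u \<ge> 0 \<Longrightarrow> exp (- C * u) * (1 + u) ^ 3 \<le> E"
    by (rule exp_minus_le_cubic[OF C(1)]) blast
  \<comment> \<open>One exp(C/4) for each of the \<open>N0\<close> factors without decay and for
    each of the at most two removed by differentiation.\<close>
  define K where "K = exp (C / 4) ^ (N0 + 2)"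
  define A where "A = 4 * pi\<^sup>2 * c"
  \<comment> \<open>The factor 1 + A + A^2 is at least 1, for the transform itself, and satisfies A
    + A^2 u <= (1 + A + A^2) (1 + u), for the second derivative.\<close>
  define D where "D = K * E * (1 + A + A\<^sup>2)"
  have K: "K > 0" by (simp add: K_def)
  have A: "A \<ge> 0" using c by (simp add: A_def)
  have D0: "D > 0" using K E(1) A by (simp add: D_def add_pos_nonneg)
  have main: "norm (fourier (mu \<nu> n) t) \<le> D / (1 + real n * t\<^sup>2) \<and>
      norm (fourier2 (mu \<nu> n) t) \<le> D * real n / (1 + real n * t\<^sup>2)\<^sup>2"
    if n: "n \<ge> 1" and t: "\<bar>t\<bar> \<le> 1/2" for n t
  proof -
    define q where "q = exp (- C * t\<^sup>2)"
    define u where "u = real n * t\<^sup>2"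
    define \<phi> where "\<phi> = (\<Sum>i=1..n. m2 (\<nu> i))"
    have u: "u \<ge> 0" by (simp add: u_def)
    have q: "0 < q" "q \<le> 1" using C(1) by (auto simp: q_def)
    have t2: "t\<^sup>2 \<le> 1/4"
      using power_mono[OF t, of 2] by (simp add: power2_eq_square)
    have "exp (- (C / 4)) \<le> q" using t2 C(1) by (simp add: q_def field_simps)
    then have iq: "1 / q \<le> exp (C / 4)" using q by (simp add: exp_minus field_simps)
    have decay: "norm (fourier (\<nu> i) t) \<le> q" if "i > N0" for i
      unfolding q_def using C(2)[OF that t] .
    note b = fourier_mu_bounds[where n = n, OF fin mean0 q decay]
    have b2: "norm (fourier2 (mu \<nu> n) t) \<le> 4 * pi\<^sup>2 * \<phi> * (q ^ (n - N0) / q)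
        + (4 * pi\<^sup>2 * \<phi> * t)\<^sup>2 * (q ^ (n - N0) / q\<^sup>2)"
      unfolding \<phi>_def by (rule b(3))
    have q1: "q ^ j / q ^ l \<le> K * exp (- C * u)" if "j = n - N0" "l \<le> 2" for j l
    proof -
      have "q ^ j / q ^ l = (q ^ j * q ^ N0) * (1 / q) ^ (N0 + l)"
        using q by (simp add: power_add power_divide)
      also have "\<dots> \<le> q ^ n * exp (C / 4) ^ (N0 + 2)"
      proof (intro mult_mono)
        \<comment> \<open>Only an inequality: j + N0 exceeds n when n < N0, because j is a truncated
          difference.\<close>
        have "q ^ (j + N0) \<le> q ^ n" using q that by (intro power_decreasing) auto
        then show "q ^ j * q ^ N0 \<le> q ^ n" by (simp add: power_add)
        have "(1 / q) ^ (N0 + l) \<le> exp (C / 4) ^ (N0 + l)" using iq q by (intro power_mono) auto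
        also have "\<dots> \<le> exp (C / 4) ^ (N0 + 2)" using that C(1) by (intro power_increasing) auto
        finally show "(1 / q) ^ (N0 + l) \<le> exp (C / 4) ^ (N0 + 2)" .
      qed (use q in auto)
      also have "q ^ n = exp (- C * u)" by (simp add: q_def u_def mult_ac flip: exp_of_nat_mult)
      finally show ?thesis by (simp add: K_def mult.commute)
    qed
    have "exp (- C * u) * (1 + u) ^ 3 \<le> E" by (rule E(2)[OF u])
    then have e3: "exp (- C * u) * (1 + u) \<le> E / (1 + u)\<^sup>2"
      using u by (simp add: pos_le_divide_eq power2_eq_square power3_eq_cube mult_ac)
    have pos: "0 < (1 + u)" using u by simp
    have "exp (- C * u) * 1 \<le> exp (- C * u) * (1 + u)\<^sup>2"
      using u by (intro mult_left_mono) auto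
    also have "\<dots> \<le> E / (1 + u)"
      using e3 pos by (simp add: pos_le_divide_eq power2_eq_square mult_ac)
    finally have e1: "exp (- C * u) \<le> E / (1 + u)" by simp
    have "norm (fourier (mu \<nu> n) t) \<le> K * exp (- C * u)"
      using order_trans[OF b(1) q1[of _ 0, simplified]] by simp
    also have "\<dots> \<le> K * (E / (1 + u))" using K e1 by (intro mult_left_mono) auto
    also have "\<dots> \<le> D / (1 + u)"
      using mult_left_mono[of 1 "1 + A + A\<^sup>2" "K * E"] A K E(1) pos
      by (simp add: D_def divide_right_mono)
    finally have r1: "norm (fourier (mu \<nu> n) t) \<le> D / (1 + u)" .
    have \<phi>: "4 * pi\<^sup>2 * \<phi> \<le> A * real n" "\<phi> \<ge> 0"
      using c(2)[OF n] by (auto simp: \<phi>_def A_def mult.assoc intro!: sum_nonneg m2_nonneg)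
    have "norm (fourier2 (mu \<nu> n) t) \<le>
        A * real n * (K * exp (- C * u)) + (A * real n * t)\<^sup>2 * (K * exp (- C * u))"
    proof (rule order_trans[OF b2], intro add_mono mult_mono[of "4 * pi\<^sup>2 * \<phi>"] mult_mono[of "(4 * pi\<^sup>2 * \<phi> * t)\<^sup>2"] \<phi>(1))
      show "q ^ (n - N0) / q \<le> K * exp (- C * u)" using q1[of "n - N0" 1] by simp
      show "q ^ (n - N0) / q\<^sup>2 \<le> K * exp (- C * u)" using q1[of "n - N0" 2] by simp
      show "(4 * pi\<^sup>2 * \<phi> * t)\<^sup>2 \<le> (A * real n * t)\<^sup>2"
        using \<phi> A by (simp add: power_mult_distrib[of _ t] mult_right_mono power_mono)
    qed (use q A K in auto)
    also have "\<dots> = real n * K * exp (- C * u) * (A + A\<^sup>2 * u)"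
      by (simp add: u_def power2_eq_square algebra_simps)
    also have "\<dots> \<le> real n * K * exp (- C * u) * ((1 + A + A\<^sup>2) * (1 + u))"
      using A K u by (intro mult_left_mono) (auto simp: algebra_simps add_nonneg_nonneg)
    also have "\<dots> = real n * K * (1 + A + A\<^sup>2) * (exp (- C * u) * (1 + u))" by (simp add: mult_ac)
    also have "\<dots> \<le> real n * K * (1 + A + A\<^sup>2) * (E / (1 + u)\<^sup>2)"
      using e3 A K by (intro mult_left_mono) auto
    also have "\<dots> = D * real n / (1 + u)\<^sup>2" by (simp add: D_def)
    finally show ?thesis using r1 by (simp add: u_def)
  qed
  show ?thesis by (rule that[OF D0]) (use main in blast)+
qed

section \<open>The maximal ergodic theorem\<close>

text \<open>The recursion computes the maximum of the Birkhoff sums of \<open>g\<close> of lengths \<open>0, \<dots>, n\<close>.\<close>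

primrec max_birkhoff :: "('a \<Rightarrow> 'a) \<Rightarrow> ('a \<Rightarrow> real) \<Rightarrow> nat \<Rightarrow> 'a \<Rightarrow> real" where
  "max_birkhoff T g 0 = (\<lambda>x. 0)"
| "max_birkhoff T g (Suc n) = (\<lambda>x. max 0 (g x + max_birkhoff T g n (T x)))"

lemma max_birkhoff_nonneg: "max_birkhoff T g n x \<ge> 0"
  by (cases n) auto

lemma max_birkhoff_mono_Suc: "max_birkhoff T g n x \<le> max_birkhoff T g (Suc n) x"
  by (induction n arbitrary: x) (auto simp: max.coboundedI2)

lemma birkhoff_sum_le_max: "(\<Sum>k<n. g ((T ^^ k) x)) \<le> max_birkhoff T g n x"
proof (induction n arbitrary: x)
  case (Suc n)
  have "(\<Sum>k<Suc n. g ((T ^^ k) x)) = g x + (\<Sum>k<n. g ((T ^^ k) (T x)))"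
    by (subst sum.lessThan_Suc_shift) (simp add: funpow_Suc_right del: funpow.simps)
  also have "\<dots> \<le> g x + max_birkhoff T g n (T x)"
    using Suc.IH by simp
  finally show ?case by simp
qed simp

context prob_space begin

context
  fixes T :: "'a \<Rightarrow> 'a" and g :: "'a \<Rightarrow> real"
  assumes T: "measure_preserving_map M T" and g: "integrable M g"
begin

lemma integrable_comp_measure_preserving:
  fixes f :: "'a \<Rightarrow> real"
  assumes "integrable M f"
  shows "integrable M (\<lambda>x. f (T x))" "(\<integral>x. f (T x) \<partial>M) = (\<integral>x. f x \<partial>M)"
  using T assms integrable_distr[of T M M f] integral_distr[of T M M f]
  unfolding measure_preserving_map_def by auto

lemma integrable_max_birkhoff: "integrable M (max_birkhoff T g n)"
  by (induction n) (auto intro!: integrable_max integrable_comp_measure_preserving g)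

text \<open>Garsia's argument: on the set where the maximal function \<open>S\<close> is positive,
  \<open>S \<le> g + S \<circ> T\<close>, and \<open>S\<close> and \<open>S \<circ> T\<close> have the same integral.\<close>
lemma max_birkhoff_ergodic:
  "0 \<le> (\<integral>x. g x * indicator {x. max_birkhoff T g n x > 0} x \<partial>M)"
proof (cases n)
  case (Suc m)
  let ?S = "max_birkhoff T g n" and ?I = "indicator {x. max_birkhoff T g n x > 0} :: 'a \<Rightarrow> real"
  have S: "integrable M ?S" and ST: "integrable M (\<lambda>x. ?S (T x))"
    by (auto intro!: integrable_max_birkhoff integrable_comp_measure_preserving)
  have [measurable]: "?S \<in> borel_measurable M" using S by auto
  \<comment> \<open>The set in the statement is not cut down to \<open>space M\<close>;
    measurability is available for the cut version, and the two integrands agree on the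
    space.\<close>
  have "integrable M (\<lambda>x. g x * indicator {x \<in> space M. ?S x > 0} x)"
    by (intro integrable_real_mult_indicator g) measurable
  then have gI: "integrable M (\<lambda>x. g x * ?I x)"
    by (rule Bochner_Integration.integrable_cong[THEN iffD1, rotated -1]) (auto simp: indicator_def)
  have "(\<integral>x. ?S x \<partial>M) \<le> (\<integral>x. g x * ?I x + ?S (T x) \<partial>M)"
  proof (rule integral_mono[OF S])
    fix x
    show "?S x \<le> g x * ?I x + ?S (T x)"
      using max_birkhoff_nonneg[of T g n "T x"] max_birkhoff_mono_Suc[of T g m "T x"]
        max_birkhoff_nonneg[of T g n x]
      by (auto simp: indicator_def Suc max_def not_less split: if_splits)
  qed (use gI ST in auto)
  also have "\<dots> = (\<integral>x. g x * ?I x \<partial>M) + (\<integral>x. ?S x \<partial>M)"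
    using gI ST integrable_comp_measure_preserving(2)[OF S] by simp
  finally show ?thesis by simp
qed simp

end

text \<open>Garsia's inequality is applied to g = F - lam, whose Birkhoff sum of length n is
  positive exactly when that of F exceeds n * lam. The sets where the finite maxima are positive
  increase with n, so a uniform bound on their measures passes to the union, which serves as
  B.\<close>

lemma maximal_ergodic_inequality:
  fixes F :: "'a \<Rightarrow> real"
  assumes T: "measure_preserving_map M T" and F: "integrable M F" and nn: "\<And>x. F x \<ge> 0" and lam: "lam > 0"
  obtains B where "B \<in> sets M" "{x \<in> space M. \<exists>n. (\<Sum>k<n. F ((T ^^ k) x)) > real n * lam} \<subseteq> B"
    "emeasure M B \<le> ennreal ((\<integral>x. F x \<partial>M) / lam)"
proof
  define g where "g x = F x - lam" for x
  have g: "integrable M g" using F by (simp add: g_def[abs_def])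
  define A where "A n = {x \<in> space M. max_birkhoff T g n x > 0}" for n
  have [measurable]: "max_birkhoff T g n \<in> borel_measurable M" for n
    using integrable_max_birkhoff[OF T g] by auto
  have A[measurable]: "A n \<in> sets M" for n unfolding A_def by measurable
  show "(\<Union>n. A n) \<in> sets M" by auto
  show "{x \<in> space M. \<exists>n. (\<Sum>k<n. F ((T ^^ k) x)) > real n * lam} \<subseteq> (\<Union>n. A n)"
  proof safe
    fix x n assume x: "x \<in> space M" and "(\<Sum>k<n. F ((T ^^ k) x)) > real n * lam"
    then have "(\<Sum>k<n. g ((T ^^ k) x)) > 0" by (simp add: g_def sum_subtractf)
    with birkhoff_sum_le_max[of g T x n] have "x \<in> A n" by (simp add: A_def x)
    then show "x \<in> (\<Union>n. A n)" by blast
  qed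
  have inc: "incseq A"
    using max_birkhoff_mono_Suc[of T g] by (intro incseq_SucI) (fastforce simp: A_def intro: less_le_trans)
  have bound: "measure M (A n) \<le> (\<integral>x. F x \<partial>M) / lam" for n
  proof -
    have "0 \<le> (\<integral>x. g x * indicator {x. max_birkhoff T g n x > 0} x \<partial>M)"
      by (rule max_birkhoff_ergodic[OF T g])
    also have "\<dots> = (\<integral>x. g x * indicator (A n) x \<partial>M)"
      by (intro Bochner_Integration.integral_cong) (auto simp: A_def indicator_def)
    also have "\<dots> \<le> (\<integral>x. F x - lam * indicator (A n) x \<partial>M)"
      using nn
      by (intro integral_mono integrable_real_mult_indicator g A Bochner_Integration.integrable_diff F
            integrable_mult_right integrable_real_indicator)
         (auto simp: g_def indicator_def less_top[symmetric] emeasure_finite)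
    also have "\<dots> = (\<integral>x. F x \<partial>M) - lam * measure M (A n)"
      using F by (simp add: less_top[symmetric] emeasure_finite)
    finally show ?thesis using lam by (simp add: field_simps)
  qed
  have "emeasure M (\<Union>n. A n) = (SUP n. emeasure M (A n))"
    using SUP_emeasure_incseq[of A M] inc A by (simp add: image_subset_iff)
  also have "\<dots> \<le> ennreal ((\<integral>x. F x \<partial>M) / lam)"
    using bound by (intro SUP_least) (simp add: emeasure_eq_measure ennreal_leI)
  finally show "emeasure M (\<Union>n. A n) \<le> ennreal ((\<integral>x. F x \<partial>M) / lam)" .
qed

end

section \<open>Integrals of Lorentzian kernels\<close>

lemma arctan_scaled_deriv:
  assumes "r > 0"
  shows "((\<lambda>t. arctan (sqrt r * t) / sqrt r) has_real_derivative 1 / (1 + r * t\<^sup>2)) (at t within S)"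
proof -
  have "((\<lambda>t. arctan (sqrt r * t)) has_real_derivative inverse (1 + (sqrt r * t)\<^sup>2) * sqrt r) (at t within S)"
    by (auto intro!: derivative_eq_intros)
  from DERIV_cdivide[OF this, of "sqrt r"] show ?thesis
    using assms by (simp add: power_mult_distrib inverse_eq_divide)
qed

text \<open>The range of arctan has length pi, whatever the endpoints; only the scaling 1 / sqrt r
  remains.\<close>

lemma arctan_scaled_diff_le:
  assumes "r > 0"
  shows "arctan (sqrt r * (1/2)) / sqrt r - arctan (sqrt r * (- 1/2)) / sqrt r \<le> pi / sqrt r"
proof -
  have "arctan (sqrt r * (1/2)) - arctan (sqrt r * (- 1/2)) \<le> pi"
    using arctan_bounded[of "sqrt r * (1/2)"] arctan_bounded[of "sqrt r * (- 1/2)"] by linarith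
  then show ?thesis
    using assms by (simp add: diff_divide_distrib[symmetric] divide_right_mono)
qed

lemma integral_lorentzian_le:
  fixes f :: "real \<Rightarrow> complex"
  assumes "r > 0" "B \<ge> 0" and f: "continuous_on {-1/2..1/2} f"
    and bound: "\<And>t. \<bar>t\<bar> \<le> 1/2 \<Longrightarrow> norm (f t) \<le> B / (1 + r * t\<^sup>2)"
  shows "integral {-1/2..1/2} (\<lambda>t. norm (f t)) \<le> B * pi / sqrt r"
proof -
  let ?I = "arctan (sqrt r * (1/2)) / sqrt r - arctan (sqrt r * (- 1/2)) / sqrt r"
  have "((\<lambda>t. 1 / (1 + r * t\<^sup>2)) has_integral ?I) {-1/2..1/2}"
    by (rule fundamental_theorem_of_calculus)
       (auto simp: has_real_derivative_iff_has_vector_derivative[symmetric] intro!: arctan_scaled_deriv assms)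
  from has_integral_mult_right[OF this, of B]
  have i: "((\<lambda>t. B / (1 + r * t\<^sup>2)) has_integral B * ?I) {-1/2..1/2}" by simp
  have "integral {-1/2..1/2} (\<lambda>t. norm (f t)) \<le> integral {-1/2..1/2} (\<lambda>t. B / (1 + r * t\<^sup>2))"
  proof (rule integral_le)
    show "(\<lambda>t. norm (f t)) integrable_on {-1/2..1/2}"
      by (intro integrable_continuous_real continuous_on_norm f)
  qed (use i bound in \<open>auto simp: integrable_on_def\<close>)
  also have "\<dots> = B * ?I" using i by (rule integral_unique)
  also have "\<dots> \<le> B * (pi / sqrt r)"
    by (intro mult_left_mono arctan_scaled_diff_le assms)
  finally show ?thesis by simp
qed

text \<open>Same primitive as in \<open>integral_lorentzian_le\<close>, for the extended integral in
  which the first claim is stated.\<close>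

lemma nn_integral_lorentzian_le:
  assumes "r > 0" "B \<ge> 0"
    and bound: "\<And>t. \<bar>t\<bar> \<le> 1/2 \<Longrightarrow> f t \<le> B / (1 + r * t\<^sup>2)"
  shows "(\<integral>\<^sup>+t\<in>{-1/2..1/2}. ennreal (f t) \<partial>lborel) \<le> ennreal (B * pi / sqrt r)"
proof -
  let ?F = "\<lambda>t. B * (arctan (sqrt r * t) / sqrt r)"
  have "(\<integral>\<^sup>+t\<in>{-1/2..1/2}. ennreal (f t) \<partial>lborel) \<le> (\<integral>\<^sup>+t\<in>{-1/2..1/2}. ennreal (B / (1 + r * t\<^sup>2)) \<partial>lborel)"
    using bound by (intro nn_integral_mono) (auto simp: indicator_def intro!: ennreal_leI)
  also have "\<dots> = ennreal (?F (1/2) - ?F (-1/2))"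
  proof (rule nn_integral_FTC_Icc)
    fix t
    show "DERIV ?F t :> B / (1 + r * t\<^sup>2)"
      using DERIV_cmult[OF arctan_scaled_deriv[OF assms(1), of t UNIV], of B] by simp
    show "0 \<le> B / (1 + r * t\<^sup>2)" using assms by (auto intro!: divide_nonneg_nonneg add_nonneg_nonneg)
  qed auto
  also have "\<dots> \<le> ennreal (B * (pi / sqrt r))"
    using mult_left_mono[OF arctan_scaled_diff_le[OF assms(1)] assms(2)]
    by (intro ennreal_leI) (simp add: right_diff_distrib)
  finally show ?thesis by simp
qed

section \<open>Kernel bounds and the maximal operator\<close>

text \<open>Both n * p(k) and k^2 * p(k) are at most D pi sqrt n; adding them and using (sqrt n +
  |k|)^2 <= 2 (n + k^2) produces the constant 4.\<close>

lemma pmf_kernel_bound: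
  assumes p: "finite_m2 p" and D: "D > 0" and n: "n \<ge> (1::nat)"
    and f0: "\<And>t. \<bar>t\<bar> \<le> 1/2 \<Longrightarrow> norm (fourier p t) \<le> D / (1 + real n * t\<^sup>2)"
    and f2: "\<And>t. \<bar>t\<bar> \<le> 1/2 \<Longrightarrow> norm (fourier2 p t) \<le> D * real n / (1 + real n * t\<^sup>2)\<^sup>2"
  shows "pmf p k \<le> 4 * D * pi * (sqrt n / (sqrt n + \<bar>real_of_int k\<bar>)\<^sup>2)"
proof -
  let ?s = "sqrt (real n)" and ?k = "real_of_int k"
  have s: "?s \<ge> 1" "?s * ?s = n" using n by auto
  have "pmf p k \<le> D * pi / ?s"
    using pmf_le_integral_fourier[of p k] integral_lorentzian_le[OF _ _ continuous_on_fourier f0] n D by force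
  then have "pmf p k * real n \<le> (D * pi / ?s) * real n"
    by (intro mult_right_mono) auto
  also have "(D * pi / ?s) * real n = D * pi * ?s"
    using s by (simp add: field_simps)
  finally have 1: "pmf p k * real n \<le> D * pi * ?s" .
  \<comment> \<open>One power of the denominator is given up, so that the same arctangent integral
    serves both bounds.\<close>
  have "norm (fourier2 p t) \<le> D * real n / (1 + real n * t\<^sup>2)" if "\<bar>t\<bar> \<le> 1/2" for t
  proof (rule order_trans[OF f2[OF that]])
    define y where "y = 1 + real n * t\<^sup>2"
    have y: "y \<ge> 1" by (simp add: y_def)
    then have "y \<le> y\<^sup>2" "0 < y\<^sup>2 * y" by (auto intro: self_le_power)
    then have "D * real n / y\<^sup>2 \<le> D * real n / y"
      using D by (intro divide_left_mono) auto
    then show "D * real n / (1 + real n * t\<^sup>2)\<^sup>2 \<le> D * real n / (1 + real n * t\<^sup>2)"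
      by (simp only: y_def)
  qed
  then have "4 * pi\<^sup>2 * (?k\<^sup>2 * pmf p k) \<le> D * real n * pi / ?s"
    using pmf_le_integral_fourier2[OF p, of k] integral_lorentzian_le[OF _ _ continuous_on_fourier2[OF p], of "real n" "D * real n"] n D
    by force
  also have "D * real n * pi / ?s = D * pi * ?s" using s by (simp add: field_simps)
  finally have "4 * pi\<^sup>2 * (?k\<^sup>2 * pmf p k) \<le> D * pi * ?s" .
  moreover have "1 * (?k\<^sup>2 * pmf p k) \<le> 4 * pi\<^sup>2 * (?k\<^sup>2 * pmf p k)"
    using pi_ge_two power_mono[OF pi_ge_two, of 2] by (intro mult_right_mono) auto
  ultimately have 2: "?k\<^sup>2 * pmf p k \<le> D * pi * ?s" by linarith
  have "(?s + \<bar>?k\<bar>)\<^sup>2 \<le> 2 * (real n + ?k\<^sup>2)"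
    using zero_le_power2[of "?s - \<bar>?k\<bar>"] s(2) by (simp add: power2_eq_square algebra_simps)
  then have "pmf p k * (?s + \<bar>?k\<bar>)\<^sup>2 \<le> pmf p k * (2 * (real n + ?k\<^sup>2))"
    by (rule mult_left_mono) simp
  also have "\<dots> \<le> 4 * D * pi * ?s" using 1 2 by (simp add: algebra_simps)
  finally have "pmf p k * (?s + \<bar>?k\<bar>)\<^sup>2 \<le> 4 * D * pi * ?s" .
  moreover have "(?s + \<bar>?k\<bar>)\<^sup>2 > 0" using s(1) by (intro zero_less_power) linarith
  ultimately show ?thesis by (simp add: pos_le_divide_eq)
qed

text \<open>Summation by parts as an induction: lowering the weight from \<open>w N\<close> to
  \<open>w (Suc N)\<close> can only raise its product with a nonpositive partial sum.\<close>

lemma abel_sum_le: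
  fixes w d :: "nat \<Rightarrow> real"
  assumes anti: "\<And>k. w (Suc k) \<le> w k" and D: "\<And>N. (\<Sum>k<N. d k) \<le> 0"
  shows "(\<Sum>k<Suc N. w k * d k) \<le> w N * (\<Sum>k<Suc N. d k)"
proof (induction N)
  case (Suc N)
  have "(\<Sum>k<Suc (Suc N). w k * d k) \<le> w N * (\<Sum>k<Suc N. d k) + w (Suc N) * d (Suc N)"
    using Suc.IH by simp
  also have "\<dots> \<le> w (Suc N) * (\<Sum>k<Suc N. d k) + w (Suc N) * d (Suc N)"
    using anti D by (intro add_right_mono mult_right_mono_neg)
  finally show ?case by (simp add: algebra_simps)
qed simp

lemma weighted_sum_le:
  fixes w g :: "nat \<Rightarrow> real"
  assumes anti: "\<And>k. w (Suc k) \<le> w k" and w: "\<And>k. w k \<ge> 0"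
    and g: "\<And>N. (\<Sum>k<N. g k) \<le> real N * lam"
  shows "(\<Sum>k<N. w k * g k) \<le> lam * (\<Sum>k<N. w k)"
proof (cases N)
  case (Suc m)
  have D: "(\<Sum>k<N. g k - lam) \<le> 0" for N using g[of N] by (simp add: sum_subtractf)
  have "(\<Sum>k<N. w k * (g k - lam)) \<le> w m * (\<Sum>k<N. g k - lam)"
    unfolding Suc by (rule abel_sum_le[where w = w and d = "\<lambda>k. g k - lam", OF anti D])
  also have "\<dots> \<le> 0" using w D by (simp add: mult_nonneg_nonpos)
  finally show ?thesis by (simp add: right_diff_distrib sum_subtractf sum_distrib_left mult.commute)
qed simp

text \<open>Telescoping: for x = s + N >= 1, x (x + 1) <= 2 x^2 gives s / x^2 <= 2s / x - 2s / (x +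
  1). The resulting bound 2 does not depend on s.\<close>

lemma sum_kernel_le:
  assumes "s \<ge> (1::real)"
  shows "(\<Sum>k<N. s / (s + real k)\<^sup>2) \<le> 2 - 2 * s / (s + real N)"
proof (induction N)
  case 0
  then show ?case using assms by simp
next
  case (Suc N)
  define x where "x = s + real N"
  have x: "x \<ge> 1" using assms by (simp add: x_def)
  have "x * (x + 1) \<le> 2 * x\<^sup>2"
    using x mult_left_mono[of 1 x x] by (simp add: power2_eq_square algebra_simps)
  then have "2 * s / (2 * x\<^sup>2) \<le> 2 * s / (x * (x + 1))"
    using x assms by (intro divide_left_mono) auto
  then have "s / x\<^sup>2 \<le> 2 * s / (x * (x + 1))" by simp
  also have "\<dots> = 2 * s / x - 2 * s / (x + 1)"
    using x by (simp add: field_simps)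
  finally have "s / (s + real N)\<^sup>2 \<le> 2 * s / (s + real N) - 2 * s / (s + real (Suc N))"
    by (simp add: x_def algebra_simps)
  with Suc.IH show ?case by simp
qed

lemma sum_kernel_mult_le:
  fixes g :: "nat \<Rightarrow> real"
  assumes s: "s \<ge> 1" and lam: "lam \<ge> 0" and g: "\<And>N. (\<Sum>k<N. g k) \<le> real N * lam"
  shows "(\<Sum>k<N. s / (s + real k)\<^sup>2 * g k) \<le> 2 * lam"
proof -
  have "(\<Sum>k<N. s / (s + real k)\<^sup>2 * g k) \<le> lam * (\<Sum>k<N. s / (s + real k)\<^sup>2)"
  proof (rule weighted_sum_le[OF _ _ g])
    fix k
    have "s + real k > 0" using s by simp
    then show "s / (s + real (Suc k))\<^sup>2 \<le> s / (s + real k)\<^sup>2"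
      using s by (intro divide_left_mono power_mono mult_pos_pos zero_less_power) auto
  qed (use s in auto)
  also have "\<dots> \<le> lam * 2"
    using sum_kernel_le[OF s, of N] s lam by (intro mult_left_mono) (auto intro: order_trans)
  finally show ?thesis by simp
qed

text \<open>Bounding all finite sums of absolute values gives summability and the estimate together.
  Each half-line contributes 2 * lam by \<open>sum_kernel_mult_le\<close>.\<close>

lemma norm_infsum_kernel_le:
  fixes g :: "int \<Rightarrow> real" and u :: "int \<Rightarrow> real"
  assumes s: "s \<ge> 1" and lam: "lam \<ge> 0" and A: "A \<ge> 0"
    and u: "\<And>k. 0 \<le> u k" "\<And>k. u k \<le> A * (s / (s + \<bar>real_of_int k\<bar>)\<^sup>2)"
    and fwd: "\<And>N. (\<Sum>k<N. \<bar>g (int k)\<bar>) \<le> real N * lam"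
    and bwd: "\<And>N. (\<Sum>k<N. \<bar>g (- int k)\<bar>) \<le> real N * lam"
  shows "\<bar>\<Sum>\<^sub>\<infinity>k. u k * g k\<bar> \<le> 4 * A * lam"
proof -
  let ?w = "\<lambda>k. s / (s + \<bar>real_of_int k\<bar>)\<^sup>2"
  have fin: "(\<Sum>k\<in>F. norm (u k * g k)) \<le> 4 * A * lam" if F: "finite F" for F
  proof -
    obtain N where N: "\<And>k. k \<in> F \<Longrightarrow> \<bar>k\<bar> < int N"
    proof
      fix k assume "k \<in> F"
      then have "\<bar>k\<bar> \<le> Max (insert 0 (abs ` F))" using F by (intro Max_ge) auto
      then show "\<bar>k\<bar> < int (nat (Max (insert 0 (abs ` F)) + 1))" by linarith
    qed
    \<comment> \<open>The index 0 lies in both halves; counting it twice is harmless for nonnegative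
      terms.\<close>
    have sub: "F \<subseteq> int ` {..<N} \<union> (\<lambda>k. - int k) ` {..<N}"
    proof
      fix k assume "k \<in> F"
      then have "nat \<bar>k\<bar> < N" using N[of k] by linarith
      moreover have "k = int (nat \<bar>k\<bar>) \<or> k = - int (nat \<bar>k\<bar>)" by linarith
      ultimately show "k \<in> int ` {..<N} \<union> (\<lambda>k. - int k) ` {..<N}" by blast
    qed
    have nn: "?w k * \<bar>g k\<bar> \<ge> 0" for k using s by simp
    have "(\<Sum>k\<in>F. norm (u k * g k)) \<le> (\<Sum>k\<in>F. A * (?w k * \<bar>g k\<bar>))"
    proof (rule sum_mono)
      fix k
      show "norm (u k * g k) \<le> A * (?w k * \<bar>g k\<bar>)"
        using mult_right_mono[OF u(2)[of k] abs_ge_zero[of "g k"]] u(1)[of k] by (simp add: abs_mult mult_ac)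
    qed
    also have "\<dots> = A * (\<Sum>k\<in>F. ?w k * \<bar>g k\<bar>)" by (simp add: sum_distrib_left)
    also have "\<dots> \<le> A * (4 * lam)"
    proof (rule mult_left_mono[OF _ A])
      have "(\<Sum>k\<in>F. ?w k * \<bar>g k\<bar>) \<le> (\<Sum>k\<in>int ` {..<N} \<union> (\<lambda>k. - int k) ` {..<N}. ?w k * \<bar>g k\<bar>)"
        using sub nn by (intro sum_mono2) auto
      also have "\<dots> \<le> (\<Sum>k\<in>int ` {..<N}. ?w k * \<bar>g k\<bar>) + (\<Sum>k\<in>(\<lambda>k. - int k) ` {..<N}. ?w k * \<bar>g k\<bar>)"
        using nn by (subst sum_Un) (auto intro!: sum_nonneg)
      also have "\<dots> = (\<Sum>k<N. ?w (int k) * \<bar>g (int k)\<bar>) + (\<Sum>k<N. ?w (- int k) * \<bar>g (- int k)\<bar>)"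
        by (simp add: sum.reindex inj_on_def)
      also have "\<dots> \<le> 2 * lam + 2 * lam"
        using sum_kernel_mult_le[OF s lam fwd] sum_kernel_mult_le[OF s lam bwd] by (intro add_mono) auto
      finally show "(\<Sum>k\<in>F. ?w k * \<bar>g k\<bar>) \<le> 4 * lam" by simp
    qed
    finally show ?thesis by simp
  qed
  have summ: "(\<lambda>k. norm (u k * g k)) summable_on UNIV"
    by (rule nonneg_bdd_above_summable_on) (auto intro!: bdd_aboveI2[of _ _ "4 * A * lam"] fin simp del: real_norm_def)
  have "norm (\<Sum>\<^sub>\<infinity>k. u k * g k) \<le> (\<Sum>\<^sub>\<infinity>k. norm (u k * g k))"
    by (rule norm_infsum_bound[OF summ])
  also have "\<dots> \<le> 4 * A * lam"
    by (rule infsum_le_finite_sums[OF summ fin])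
  finally show ?thesis by simp
qed

text \<open>Below the threshold N of the O-bound, monotonicity gives f n <= f N <= f N * n, which
  needs n >= 1.\<close>

lemma linear_bound_of_bigo:
  fixes f :: "nat \<Rightarrow> real"
  assumes "mono f" "\<And>n. f n \<ge> 0" "f \<in> O(\<lambda>n. real n)"
  obtains c where "c \<ge> 0" "\<And>n. n \<ge> 1 \<Longrightarrow> f n \<le> c * real n"
proof -
  obtain c0 where "c0 > 0" "eventually (\<lambda>n. norm (f n) \<le> c0 * norm (real n)) at_top"
    using assms(3) by (elim landau_o.bigE)
  then obtain N where N: "\<And>n. n \<ge> N \<Longrightarrow> f n \<le> c0 * real n"
    using assms(2) by (auto simp: eventually_at_top_linorder)
  show ?thesis
  proof
    show "max c0 (f N) \<ge> 0" using assms(2)[of N] by simp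
    fix n :: nat assume n: "n \<ge> 1"
    show "f n \<le> max c0 (f N) * real n"
    proof (cases "n \<ge> N")
      case True
      then show ?thesis using N[of n] mult_right_mono[of c0 "max c0 (f N)" "real n"] by simp
    next
      case False
      then have "f n \<le> f N" using assms(1) by (simp add: monoD)
      also have "\<dots> \<le> max c0 (f N) * 1" by simp
      also have "\<dots> \<le> max c0 (f N) * real n" using n assms(2)[of N] by (intro mult_left_mono) auto
      finally show ?thesis .
    qed
  qed
qed

text \<open>The scale s may vary with the index, but A may not. Off two exceptional sets the
  averages of |f| along \<open>\<tau>\<close> and along its inverse stay below l = lam / (4A), which
  forces every kernel average below 4 A l = lam. Each set has measure at most 4 A / lam times the
  norm of f, hence the 8.\<close>

lemma weak_type_of_kernel_bound:
  fixes p :: "'i \<Rightarrow> int pmf"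
  assumes M: "prob_space M" and T: "measure_preserving_map M \<tau>"
    and T': "measure_preserving_map M (the_inv_into (space M) \<tau>)"
    and A: "A > 0"
    and ker: "\<And>i. i \<in> I \<Longrightarrow> \<exists>s\<ge>1. \<forall>k. pmf (p i) k \<le> A * (s / (s + \<bar>real_of_int k\<bar>)\<^sup>2)"
    and lam: "lam > 0" and f: "integrable M f"
  shows "\<exists>B\<in>sets M. {x\<in>space M. (SUP i\<in>I. ennreal \<bar>avg M \<tau> (p i) f x\<bar>) > ennreal lam} \<subseteq> B
     \<and> emeasure M B \<le> ennreal (8 * A / lam * (\<integral>x. \<bar>f x\<bar> \<partial>M))"
proof -
  interpret prob_space M by fact
  define l where "l = lam / (4 * A)"
  have l: "l > 0" using lam A by (simp add: l_def)
  have F: "integrable M (\<lambda>x. \<bar>f x\<bar>)" using f by simp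
  obtain B1 where B1: "B1 \<in> sets M" "{x \<in> space M. \<exists>n. (\<Sum>k<n. \<bar>f ((\<tau> ^^ k) x)\<bar>) > real n * l} \<subseteq> B1"
    "emeasure M B1 \<le> ennreal ((\<integral>x. \<bar>f x\<bar> \<partial>M) / l)"
    by (rule maximal_ergodic_inequality[OF T F _ l]) auto
  obtain B2 where B2: "B2 \<in> sets M"
    "{x \<in> space M. \<exists>n. (\<Sum>k<n. \<bar>f ((the_inv_into (space M) \<tau> ^^ k) x)\<bar>) > real n * l} \<subseteq> B2"
    "emeasure M B2 \<le> ennreal ((\<integral>x. \<bar>f x\<bar> \<partial>M) / l)"
    by (rule maximal_ergodic_inequality[OF T' F _ l]) auto
  show ?thesis
  proof (intro bexI conjI)
    show "B1 \<union> B2 \<in> sets M" using B1 B2 by auto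
    have "emeasure M (B1 \<union> B2) \<le> emeasure M B1 + emeasure M B2"
      using B1(1) B2(1) by (rule emeasure_subadditive)
    also have "\<dots> \<le> ennreal ((\<integral>x. \<bar>f x\<bar> \<partial>M) / l) + ennreal ((\<integral>x. \<bar>f x\<bar> \<partial>M) / l)"
      using B1(3) B2(3) by (rule add_mono)
    also have "\<dots> = ennreal (8 * A / lam * (\<integral>x. \<bar>f x\<bar> \<partial>M))"
      using l A lam by (subst ennreal_plus[symmetric]) (auto simp: l_def field_simps)
    finally show "emeasure M (B1 \<union> B2) \<le> ennreal (8 * A / lam * (\<integral>x. \<bar>f x\<bar> \<partial>M))" .
    show "{x\<in>space M. (SUP i\<in>I. ennreal \<bar>avg M \<tau> (p i) f x\<bar>) > ennreal lam} \<subseteq> B1 \<union> B2"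
    proof (rule subsetI, rule ccontr)
      fix x assume x: "x \<in> {x\<in>space M. (SUP i\<in>I. ennreal \<bar>avg M \<tau> (p i) f x\<bar>) > ennreal lam}"
        and nB: "x \<notin> B1 \<union> B2"
      have fwd: "(\<Sum>k<N. \<bar>f ((\<tau> ^^ k) x)\<bar>) \<le> real N * l" for N
        using x nB B1(2) by (force simp: not_less[symmetric])
      have bwd: "(\<Sum>k<N. \<bar>f ((the_inv_into (space M) \<tau> ^^ k) x)\<bar>) \<le> real N * l" for N
        using x nB B2(2) by (force simp: not_less[symmetric])
      \<comment> \<open>For k = 0 the second equation falls into the nonnegative branch of
        \<open>tpow\<close>; both sides are then the identity.\<close>
      have tp: "tpow M \<tau> (int k) x = (\<tau> ^^ k) x"
        "tpow M \<tau> (- int k) x = (the_inv_into (space M) \<tau> ^^ k) x" for k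
        by (simp_all add: tpow_def)
      have "ennreal \<bar>avg M \<tau> (p i) f x\<bar> \<le> ennreal lam" if i: "i \<in> I" for i
      proof -
        obtain s where s: "s \<ge> 1" "\<And>k. pmf (p i) k \<le> A * (s / (s + \<bar>real_of_int k\<bar>)\<^sup>2)"
          using ker[OF i] by blast
        have "\<bar>avg M \<tau> (p i) f x\<bar> \<le> 4 * A * l"
          unfolding avg_def using A l s fwd bwd
          by (intro norm_infsum_kernel_le[of s]) (auto simp: tp)
        also have "\<dots> = lam" using A by (simp add: l_def)
        finally show ?thesis by (rule ennreal_leI)
      qed
      then have "(SUP i\<in>I. ennreal \<bar>avg M \<tau> (p i) f x\<bar>) \<le> ennreal lam" by (rule SUP_least)
      with x show False using not_less by blast
    qed
  qed
qed

theorem theorem2p1p3: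
  fixes M :: "'a measure" and \<tau> :: "'a \<Rightarrow> 'a" and \<nu> :: "nat \<Rightarrow> int pmf"
  assumes "prob_space M" and "non_atomic M" and "separable_measure M"
    and "bij_betw \<tau> (space M) (space M)"
    and "measure_preserving_map M \<tau>"
    and "measure_preserving_map M (the_inv_into (space M) \<tau>)"
    and aper: "\<And>n. n \<ge> 1 \<Longrightarrow> strictly_aperiodic (\<nu> n)"
    and mean0: "\<And>n. n \<ge> 1 \<Longrightarrow> mean (\<nu> n) = 0"
    and m2_fin: "\<And>n. n \<ge> 1 \<Longrightarrow> (\<lambda>k. (real_of_int k)\<^sup>2 * pmf (\<nu> n) k) summable_on UNIV"
    and phi: "(\<lambda>n. \<Sum>i=1..n. m2 (\<nu> i)) \<in> O(\<lambda>n. real n)"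
    and gauss: "\<exists>C>0. \<exists>N0::nat>0. \<forall>n>N0. \<forall>t\<in>{-1/2..<1/2}. norm (fourier (\<nu> n) t) \<le> exp (- C * t\<^sup>2)"
  shows "(SUP n\<in>{1..}. \<integral>\<^sup>+ t\<in>{-1/2..1/2}.
            ennreal (norm (vector_derivative (\<lambda>s. vector_derivative (fourier (mu \<nu> n)) (at s)) (at t)) * \<bar>t\<bar>) \<partial>lborel) < \<infinity>
    \<and> (\<exists>C'. \<forall>lam>0. \<forall>f. integrable M f \<longrightarrow>
          (\<exists>B\<in>sets M. {x\<in>space M. (SUP n\<in>{1..}. ennreal \<bar>avg M \<tau> (mu \<nu> n) f x\<bar>) > ennreal lam} \<subseteq> B
             \<and> emeasure M B \<le> ennreal (C' / lam * (\<integral>x. \<bar>f x\<bar> \<partial>M))))"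
proof -
  have fin: "finite_m2 (\<nu> i)" if "i \<ge> 1" for i
    using m2_fin[OF that] by (simp add: finite_m2_def)
  have fin_mu: "finite_m2 (mu \<nu> n)" for n
    by (rule finite_m2_mu[OF fin])
  have "mono (\<lambda>n. \<Sum>i=1..n. m2 (\<nu> i))"
    by (intro monoI sum_mono2) (auto simp: m2_nonneg)
  then obtain c where c: "c \<ge> 0" "\<And>n. n \<ge> 1 \<Longrightarrow> (\<Sum>i=1..n. m2 (\<nu> i)) \<le> c * real n"
    by (rule linear_bound_of_bigo[OF _ _ phi]) (auto intro: sum_nonneg m2_nonneg)
  obtain C N0 where C: "C > 0"
    "\<And>n t. n > N0 \<Longrightarrow> t \<in> {-1/2..<1/2} \<Longrightarrow> norm (fourier (\<nu> n) t) \<le> exp (- C * t\<^sup>2)"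
    using gauss by blast
  have decay: "norm (fourier (\<nu> n) t) \<le> exp (- C * t\<^sup>2)" if "n > N0" "\<bar>t\<bar> \<le> 1/2" for n t
  proof -
    \<comment> \<open>The point -|t| always lies in the half-open interval, also for t =
      1/2.\<close>
    have "norm (fourier (\<nu> n) (- \<bar>t\<bar>)) \<le> exp (- C * (- \<bar>t\<bar>)\<^sup>2)"
      using that by (intro C(2)) auto
    moreover have "norm (fourier (\<nu> n) (- \<bar>t\<bar>)) = norm (fourier (\<nu> n) t)"
      by (cases "t \<ge> 0") (auto simp: norm_fourier_minus)
    ultimately show ?thesis by simp
  qed
  obtain D where D: "D > 0"
    "\<And>n t. n \<ge> 1 \<Longrightarrow> \<bar>t\<bar> \<le> 1/2 \<Longrightarrow> norm (fourier (mu \<nu> n) t) \<le> D / (1 + real n * t\<^sup>2)"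
    "\<And>n t. n \<ge> 1 \<Longrightarrow> \<bar>t\<bar> \<le> 1/2 \<Longrightarrow> norm (fourier2 (mu \<nu> n) t) \<le> D * real n / (1 + real n * t\<^sup>2)\<^sup>2"
    by (rule fourier_mu_decay[OF fin mean0 c C(1) decay]) blast+
  have deriv: "vector_derivative (\<lambda>s. vector_derivative (fourier (mu \<nu> n)) (at s)) (at t) = fourier2 (mu \<nu> n) t" for n t
  proof -
    have "(\<lambda>s. vector_derivative (fourier (mu \<nu> n)) (at s)) = fourier1 (mu \<nu> n)"
      using fourier_has_vector_derivative[OF fin_mu] by (auto intro: vector_derivative_at)
    then show ?thesis
      using fourier1_has_vector_derivative[OF fin_mu] by (simp add: vector_derivative_at)
  qed
  have "(\<integral>\<^sup>+ t\<in>{-1/2..1/2}. ennreal (norm (fourier2 (mu \<nu> n) t) * \<bar>t\<bar>) \<partial>lborel) \<le> ennreal (D * pi)"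
    if n: "n \<in> {1..}" for n
  proof -
    let ?s = "sqrt (real n)"
    have s: "?s \<ge> 1" "?s * ?s = real n" using n by auto
    \<comment> \<open>The weight pays for one power of the denominator: sqrt n |t| <= 1 + n t^2.
      What remains is sqrt n times a Lorentzian of mass at most pi / sqrt n, so n cancels.\<close>
    have "norm (fourier2 (mu \<nu> n) t) * \<bar>t\<bar> \<le> D * ?s / (1 + real n * t\<^sup>2)" if t: "\<bar>t\<bar> \<le> 1/2" for t
    proof -
      define y where "y = 1 + real n * t\<^sup>2"
      have y: "y \<ge> 1" by (simp add: y_def)
      have "2 * (?s * \<bar>t\<bar>) \<le> 1 + (?s * \<bar>t\<bar>)\<^sup>2"
        using zero_le_power2[of "?s * \<bar>t\<bar> - 1"] by (simp add: power2_eq_square algebra_simps)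
      also have "\<dots> = y" by (simp add: y_def power_mult_distrib)
      finally have st: "?s * \<bar>t\<bar> \<le> y" using y by linarith
      have "norm (fourier2 (mu \<nu> n) t) * \<bar>t\<bar> \<le> D * real n / y\<^sup>2 * \<bar>t\<bar>"
        using D(3)[of n t] n t by (intro mult_right_mono) (auto simp: y_def)
      also have "\<dots> = D * (?s * ?s) * \<bar>t\<bar> / y\<^sup>2"
        by (simp only: s(2) times_divide_eq_left)
      also have "\<dots> = D * ?s * (?s * \<bar>t\<bar>) / y\<^sup>2"
        by (simp only: mult.assoc)
      also have "\<dots> \<le> D * ?s * y / y\<^sup>2"
        using st D(1) by (intro divide_right_mono mult_left_mono) auto
      also have "\<dots> = D * ?s / y" using y by (simp add: power2_eq_square)
      finally show ?thesis by (simp add: y_def)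
    qed
    then have "(\<integral>\<^sup>+ t\<in>{-1/2..1/2}. ennreal (norm (fourier2 (mu \<nu> n) t) * \<bar>t\<bar>) \<partial>lborel)
        \<le> ennreal (D * ?s * pi / ?s)"
      using n D(1) by (intro nn_integral_lorentzian_le) auto
    then show ?thesis using s by simp
  qed
  then have "(SUP n\<in>{1..}. \<integral>\<^sup>+ t\<in>{-1/2..1/2}. ennreal (norm (fourier2 (mu \<nu> n) t) * \<bar>t\<bar>) \<partial>lborel) \<le> ennreal (D * pi)"
    by (rule SUP_least)
  also have "\<dots> < \<infinity>" by simp
  finally have 1: "(SUP n\<in>{1..}. \<integral>\<^sup>+ t\<in>{-1/2..1/2}. ennreal (norm (fourier2 (mu \<nu> n) t) * \<bar>t\<bar>) \<partial>lborel) < \<infinity>" .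
  have ker: "\<exists>s\<ge>1. \<forall>k. pmf (mu \<nu> n) k \<le> 4 * D * pi * (s / (s + \<bar>real_of_int k\<bar>)\<^sup>2)" if "n \<in> {1..}" for n
    using that D by (intro exI[of _ "sqrt (real n)"] conjI allI pmf_kernel_bound fin_mu) auto
  have A: "4 * D * pi > 0" using D(1) by simp
  show ?thesis
    unfolding deriv
  proof (intro conjI 1 exI allI impI)
    fix lam :: real and f :: "'a \<Rightarrow> real"
    assume "0 < lam" "integrable M f"
    then show "\<exists>B\<in>sets M. {x\<in>space M. (SUP n\<in>{1..}. ennreal \<bar>avg M \<tau> (mu \<nu> n) f x\<bar>) > ennreal lam} \<subseteq> B
        \<and> emeasure M B \<le> ennreal (8 * (4 * D * pi) / lam * (\<integral>x. \<bar>f x\<bar> \<partial>M))"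
      by (intro weak_type_of_kernel_bound[OF assms(1,5,6) A ker])
  qed
qed

end
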